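(* Let $X=\ell^2(\mathbb{N}^2)$ (complex), let $E$ be the set of all real contractions on $X$ endowed with the strong operator topology, let $M$ be the set of all $T\in E$ which are embeddable into a real contractive $C_0$-semigroup on $X$, and let $L$ be the infinite-dimensional backward unilateral shift on $X$. Then the conjugacy class $$O(L):=\{S^{-1}LS:\ S \text{ real unitary operator on } X\}$$ is a residual subset of $E$ with $O(L)\subset M$. In particular, $M$ is residual in $E$.
   Context: $\mathbb{N}=\{1,2,\ldots\}$ and $\ell^2(\mathbb{N}^2)=\{(x_{j,n})_{j,n\in\mathbb{N}}\in\mathbb{C}^{\mathbb{N}^2}: \sum_{j,n=1}^\infty|x_{j,n}|^2<\infty\}$ with canonical orthonormal basis $(e_j(n))_{j,n\in\mathbb{N}}$. A bounded linear operator on $X$ is real if it maps the real sequences in $X$ to real sequences; a contraction is an operator of norm at most $1$. A $C_0$-semigroup $(T(t))_{t\ge0}$ is real (contractive) if every $T(t)$ is real (a contraction); $T$ is embeddable into $(T(t))_{t\ge0}$ if $T(1)=T$. The shift $L$ is the bounded linear operator on $\ell^2(\mathbb{N}^2)$ determined by $L(e_1(n))=0$ and $L(e_{j+1}(n))=e_j(n)$ for $j,n\in\mathbb{N}$. A subset of a topological space is meager if it is a countable union of nowhere dense sets, and residual if its complement is meager. The space $E$ with the strong operator topology is completely metrizable, e.g. by the metric $d(T,S)=\sum_{n,j=1}^\infty 2^{-(n+j)}\|T(e_j(n))-S(e_j(n))\|$. *)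

theory Defs
  imports "HOL-Analysis.Analysis"
begin

section \<open>The complex Hilbert space of square-summable double sequences\<close>

text \<open>
  Positive indices \<open>1, 2, \<dots>\<close> are represented by \<open>0, 1, \<dots>\<close> of type \<^typ>\<open>nat\<close>: the coordinate
  with index \<open>(j, n)\<close> below is the one with index \<open>(j + 1, n + 1)\<close> in the usual numbering.
\<close>

typedef ell2 = "{x :: nat \<times> nat \<Rightarrow> complex. (\<lambda>p. (cmod (x p))\<^sup>2) summable_on UNIV}"
  morphisms coord Abs_ell2
  by (rule exI[of _ "\<lambda>_. 0"]) simp

setup_lifting type_definition_ell2

lemma ell2_eqI: "(\<And>p. coord x p = coord y p) \<Longrightarrow> x = y"
  by (simp add: coord_inject[symmetric] fun_eq_iff)

lemma square_summable_coord: "(\<lambda>p. (cmod (coord x p))\<^sup>2) summable_on A"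
  using coord[of x] summable_on_subset_banach by blast

lemma square_summable_add:
  fixes x y :: "'a \<Rightarrow> complex"
  assumes "(\<lambda>p. (cmod (x p))\<^sup>2) summable_on A" "(\<lambda>p. (cmod (y p))\<^sup>2) summable_on A"
  shows "(\<lambda>p. (cmod (x p + y p))\<^sup>2) summable_on A"
proof (rule summable_on_comparison_test)
  show "(\<lambda>p. 2 * (cmod (x p))\<^sup>2 + 2 * (cmod (y p))\<^sup>2) summable_on A"
    by (intro summable_on_add summable_on_cmult_right assms)
  fix p
  have "(cmod (x p + y p))\<^sup>2 \<le> (cmod (x p) + cmod (y p))\<^sup>2"
    by (intro power_mono norm_triangle_ineq) simp
  also have "\<dots> \<le> 2 * (cmod (x p))\<^sup>2 + 2 * (cmod (y p))\<^sup>2"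
    using sum_squares_bound[of "cmod (x p)" "cmod (y p)"] by (simp add: power2_sum)
  finally show "(cmod (x p + y p))\<^sup>2 \<le> 2 * (cmod (x p))\<^sup>2 + 2 * (cmod (y p))\<^sup>2" .
qed simp

lemma square_summable_cmult:
  fixes x :: "'a \<Rightarrow> complex"
  assumes "(\<lambda>p. (cmod (x p))\<^sup>2) summable_on A"
  shows "(\<lambda>p. (cmod (c * x p))\<^sup>2) summable_on A"
  using summable_on_cmult_right[OF assms, of "(cmod c)\<^sup>2"]
  by (simp add: norm_mult power_mult_distrib)

instantiation ell2 :: ab_group_add
begin

lift_definition zero_ell2 :: ell2 is "\<lambda>_. 0"
  by simp

lift_definition plus_ell2 :: "ell2 \<Rightarrow> ell2 \<Rightarrow> ell2" is "\<lambda>x y p. x p + y p"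
  by (rule square_summable_add)

lift_definition uminus_ell2 :: "ell2 \<Rightarrow> ell2" is "\<lambda>x p. - x p"
  by simp

definition minus_ell2 :: "ell2 \<Rightarrow> ell2 \<Rightarrow> ell2" where
  "minus_ell2 x y = x + - y"

instance
  by standard
    (auto intro!: ell2_eqI simp: plus_ell2.rep_eq zero_ell2.rep_eq uminus_ell2.rep_eq minus_ell2_def)

end

lift_definition scaleC :: "complex \<Rightarrow> ell2 \<Rightarrow> ell2"  (infixr \<open>*\<^sub>C\<close> 75) is "\<lambda>c x p. c * x p"
  by (rule square_summable_cmult)

instantiation ell2 :: real_normed_vector
begin

definition scaleR_ell2 :: "real \<Rightarrow> ell2 \<Rightarrow> ell2" where
  "scaleR_ell2 r x = complex_of_real r *\<^sub>C x"

definition norm_ell2 :: "ell2 \<Rightarrow> real" where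
  "norm_ell2 x = sqrt (\<Sum>\<^sub>\<infinity>p. (cmod (coord x p))\<^sup>2)"

definition dist_ell2 :: "ell2 \<Rightarrow> ell2 \<Rightarrow> real" where
  "dist_ell2 x y = norm (x - y)"

definition sgn_ell2 :: "ell2 \<Rightarrow> ell2" where
  "sgn_ell2 x = inverse (norm x) *\<^sub>R x"

definition uniformity_ell2 :: "(ell2 \<times> ell2) filter" where
  "uniformity_ell2 = (INF e\<in>{0<..}. principal {(x, y). dist x y < e})"

definition open_ell2 :: "ell2 set \<Rightarrow> bool" where
  "open_ell2 U = (\<forall>x\<in>U. \<forall>\<^sub>F (x', y) in uniformity. x' = x \<longrightarrow> y \<in> U)"

instance
proof
  fix x y :: ell2 and a b :: real
  show "a *\<^sub>R (x + y) = a *\<^sub>R x + a *\<^sub>R y" "(a + b) *\<^sub>R x = a *\<^sub>R x + b *\<^sub>R x"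
    "a *\<^sub>R b *\<^sub>R x = (a * b) *\<^sub>R x" "1 *\<^sub>R x = x"
    by (auto intro!: ell2_eqI simp: scaleR_ell2_def scaleC.rep_eq plus_ell2.rep_eq algebra_simps)
  show "(norm x = 0) = (x = 0)"
  proof
    assume "norm x = 0"
    then have "(\<Sum>\<^sub>\<infinity>p. (cmod (coord x p))\<^sup>2) = 0"
      by (simp add: norm_ell2_def)
    then have "(cmod (coord x p))\<^sup>2 = 0" for p
      by (rule nonneg_infsum_le_0D[OF eq_refl]) (auto simp: square_summable_coord)
    then show "x = 0"
      by (auto intro!: ell2_eqI simp: zero_ell2.rep_eq)
  qed (simp add: norm_ell2_def zero_ell2.rep_eq)
  have partial: "L2_set (\<lambda>p. cmod (coord z p)) F \<le> norm z" if "finite F" for z F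
    unfolding L2_set_def norm_ell2_def
    by (intro real_sqrt_le_mono finite_sum_le_infsum square_summable_coord that) auto
  have "(\<Sum>\<^sub>\<infinity>p. (cmod (coord (x + y) p))\<^sup>2) \<le> (norm x + norm y)\<^sup>2"
  proof (rule infsum_le_finite_sums[OF square_summable_coord])
    fix F :: "(nat \<times> nat) set"
    assume F: "finite F"
    have "L2_set (\<lambda>p. cmod (coord (x + y) p)) F
        \<le> L2_set (\<lambda>p. cmod (coord x p) + cmod (coord y p)) F"
      by (intro L2_set_mono) (auto simp: plus_ell2.rep_eq norm_triangle_ineq)
    also have "\<dots> \<le> L2_set (\<lambda>p. cmod (coord x p)) F + L2_set (\<lambda>p. cmod (coord y p)) F"
      by (rule L2_set_triangle_ineq)
    also have "\<dots> \<le> norm x + norm y"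
      by (intro add_mono partial F)
    finally show "(\<Sum>p\<in>F. (cmod (coord (x + y) p))\<^sup>2) \<le> (norm x + norm y)\<^sup>2"
      by (simp add: L2_set_def real_sqrt_le_iff real_le_lsqrt sqrt_le_D)
  qed
  moreover have "norm x + norm y \<ge> 0"
    by (simp add: norm_ell2_def infsum_nonneg)
  ultimately show "norm (x + y) \<le> norm x + norm y"
    by (simp add: norm_ell2_def[of "x + y"] real_le_lsqrt)
  have "(\<Sum>\<^sub>\<infinity>p. (cmod (coord (a *\<^sub>R x) p))\<^sup>2) = a\<^sup>2 * (\<Sum>\<^sub>\<infinity>p. (cmod (coord x p))\<^sup>2)"
    by (simp add: scaleR_ell2_def scaleC.rep_eq norm_mult power_mult_distrib
        infsum_cmult_right square_summable_coord)
  then show "norm (a *\<^sub>R x) = \<bar>a\<bar> * norm x"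
    by (simp add: norm_ell2_def real_sqrt_mult)
qed (rule dist_ell2_def sgn_ell2_def uniformity_ell2_def open_ell2_def)+

end

definition cinner :: "ell2 \<Rightarrow> ell2 \<Rightarrow> complex" where
  "cinner x y = (\<Sum>\<^sub>\<infinity>p. coord x p * cnj (coord y p))"

lemma cinner_abs_summable: "(\<lambda>p. norm (coord x p * cnj (coord y p))) summable_on UNIV"
proof (rule summable_on_comparison_test)
  show "(\<lambda>p. (cmod (coord x p))\<^sup>2 + (cmod (coord y p))\<^sup>2) summable_on UNIV"
    by (intro summable_on_add square_summable_coord)
  show "norm (coord x p * cnj (coord y p)) \<le> (cmod (coord x p))\<^sup>2 + (cmod (coord y p))\<^sup>2" for p
    using sum_squares_bound[of "cmod (coord x p)" "cmod (coord y p)"]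
      mult_nonneg_nonneg[OF norm_ge_zero norm_ge_zero, of "coord x p" "coord y p"]
    unfolding norm_mult complex_mod_cnj by linarith
qed simp

lemma cinner_self: "cinner x x = complex_of_real ((norm x)\<^sup>2)"
proof -
  have "cinner x x = (\<Sum>\<^sub>\<infinity>p. complex_of_real ((cmod (coord x p))\<^sup>2))"
    unfolding cinner_def by (simp add: complex_norm_square del: of_real_power)
  also have "\<dots> = complex_of_real (\<Sum>\<^sub>\<infinity>p. (cmod (coord x p))\<^sup>2)"
    by (intro infsumI has_sum_bounded_linear[OF bounded_linear_of_real] has_sum_infsum
        square_summable_coord)
  also have "(\<Sum>\<^sub>\<infinity>p. (cmod (coord x p))\<^sup>2) = (norm x)\<^sup>2"
    by (simp add: norm_ell2_def infsum_nonneg)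
  finally show ?thesis .
qed

lift_definition unit_vec :: "nat \<Rightarrow> nat \<Rightarrow> ell2" is "\<lambda>j n p. if p = (j, n) then 1 else 0"
proof -
  fix j n :: nat
  have "(\<lambda>p. (cmod (if p = (j, n) then 1 else 0))\<^sup>2) summable_on {(j, n)}"
    by simp
  then show "(\<lambda>p. (cmod (if p = (j, n) then 1 else 0))\<^sup>2) summable_on UNIV"
    by (rule summable_on_cong_neutral[THEN iffD1, rotated -1]) auto
qed

section \<open>Operators\<close>

text \<open>
  The type \<^typ>\<open>ell2 \<Rightarrow>\<^sub>L ell2\<close> consists of the bounded \<^emph>\<open>real\<close>-linear maps; complex homogeneity is
  therefore a separate condition.
\<close>

definition clinear :: "(ell2 \<Rightarrow>\<^sub>L ell2) \<Rightarrow> bool" where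
  "clinear T \<longleftrightarrow> (\<forall>c x. T (c *\<^sub>C x) = c *\<^sub>C T x)"

definition real_seqs :: "ell2 set" where
  "real_seqs = {x. \<forall>p. coord x p \<in> \<real>}"

definition real_operator :: "(ell2 \<Rightarrow>\<^sub>L ell2) \<Rightarrow> bool" where
  "real_operator T \<longleftrightarrow> clinear T \<and> (\<forall>x\<in>real_seqs. T x \<in> real_seqs)"

definition contraction :: "(ell2 \<Rightarrow>\<^sub>L ell2) \<Rightarrow> bool" where
  "contraction T \<longleftrightarrow> norm T \<le> 1"

definition unitary :: "(ell2 \<Rightarrow>\<^sub>L ell2) \<Rightarrow> bool" where
  "unitary S \<longleftrightarrow> clinear S \<and> surj S \<and> (\<forall>x y. cinner (S x) (S y) = cinner x y)"

definition C0_semigroup :: "(real \<Rightarrow> ell2 \<Rightarrow>\<^sub>L ell2) \<Rightarrow> bool" where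
  "C0_semigroup T \<longleftrightarrow>
     (\<forall>t\<ge>0. clinear (T t)) \<and> T 0 = id_blinfun \<and>
     (\<forall>s\<ge>0. \<forall>t\<ge>0. T (s + t) = T s o\<^sub>L T t) \<and>
     (\<forall>x. continuous_on {0..} (\<lambda>t. T t x))"

definition real_contractive_C0_semigroup :: "(real \<Rightarrow> ell2 \<Rightarrow>\<^sub>L ell2) \<Rightarrow> bool" where
  "real_contractive_C0_semigroup T \<longleftrightarrow>
     C0_semigroup T \<and> (\<forall>t\<ge>0. real_operator (T t) \<and> contraction (T t))"

definition real_contractions :: "(ell2 \<Rightarrow>\<^sub>L ell2) set" where
  "real_contractions = {T. real_operator T \<and> contraction T}"

definition sot_real_contractions :: "(ell2 \<Rightarrow>\<^sub>L ell2) topology" where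
  "sot_real_contractions = subtopology strong_operator_topology real_contractions"

definition embeddable_real_contractions :: "(ell2 \<Rightarrow>\<^sub>L ell2) set" where
  "embeddable_real_contractions =
     {T \<in> real_contractions. \<exists>U. real_contractive_C0_semigroup U \<and> U 1 = T}"

lemma summable_shift:
  assumes "(\<lambda>p. (cmod (x p))\<^sup>2) summable_on UNIV"
  shows "(\<lambda>(j, n). (cmod (x (Suc j, n)))\<^sup>2) summable_on UNIV"
proof -
  have "(\<lambda>p. (cmod (x p))\<^sup>2) summable_on range (map_prod Suc id)"
    using assms summable_on_subset_banach by blast
  then show ?thesis
    by (subst (asm) summable_on_reindex) (auto simp: o_def case_prod_unfold inj_on_def map_prod_def)
qed

lift_definition shift_fun :: "ell2 \<Rightarrow> ell2" is "\<lambda>x (j, n). x (Suc j, n)"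
  using summable_shift by (simp add: case_prod_unfold)

lemma norm_shift_fun_le: "norm (shift_fun x) \<le> norm x"
proof -
  have "(\<Sum>\<^sub>\<infinity>p. (cmod (coord (shift_fun x) p))\<^sup>2)
      = (\<Sum>\<^sub>\<infinity>p\<in>range (map_prod Suc id). (cmod (coord x p))\<^sup>2)"
    by (subst infsum_reindex) (auto simp: inj_on_def o_def case_prod_unfold map_prod_def shift_fun.rep_eq)
  also have "\<dots> \<le> (\<Sum>\<^sub>\<infinity>p. (cmod (coord x p))\<^sup>2)"
    by (intro infsum_mono2 square_summable_coord) auto
  finally show ?thesis
    by (simp add: norm_ell2_def)
qed

lift_definition backward_shift :: "ell2 \<Rightarrow>\<^sub>L ell2" is shift_fun
proof (rule bounded_linear_intro)
  show "shift_fun (x + y) = shift_fun x + shift_fun y" for x y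
    by (auto intro!: ell2_eqI simp: shift_fun.rep_eq plus_ell2.rep_eq)
  show "shift_fun (r *\<^sub>R x) = r *\<^sub>R shift_fun x" for r x
    by (auto intro!: ell2_eqI simp: shift_fun.rep_eq scaleR_ell2_def scaleC.rep_eq)
  show "norm (shift_fun x) \<le> norm x * 1" for x
    by (simp add: norm_shift_fun_le)
qed

lemma clinear_backward_shift: "clinear backward_shift"
  by (auto intro!: ell2_eqI simp: clinear_def backward_shift.rep_eq shift_fun.rep_eq scaleC.rep_eq)

lemma backward_shift_unit_vec_0: "backward_shift (unit_vec 0 n) = 0"
  by (auto intro!: ell2_eqI simp: backward_shift.rep_eq shift_fun.rep_eq unit_vec.rep_eq zero_ell2.rep_eq)

lemma backward_shift_unit_vec_Suc: "backward_shift (unit_vec (Suc j) n) = unit_vec j n"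
  by (auto intro!: ell2_eqI simp: backward_shift.rep_eq shift_fun.rep_eq unit_vec.rep_eq)

definition real_unitary_orbit :: "(ell2 \<Rightarrow>\<^sub>L ell2) \<Rightarrow> (ell2 \<Rightarrow>\<^sub>L ell2) set" where
  "real_unitary_orbit A =
     {T. \<exists>S. real_operator S \<and> unitary S \<and>
             blinfun_apply T = inv (blinfun_apply S) \<circ> blinfun_apply A \<circ> blinfun_apply S}"

section \<open>Baire category\<close>

definition nowhere_dense_in :: "'a topology \<Rightarrow> 'a set \<Rightarrow> bool" where
  "nowhere_dense_in X A \<longleftrightarrow> A \<subseteq> topspace X \<and> X interior_of (X closure_of A) = {}"

definition meager_in :: "'a topology \<Rightarrow> 'a set \<Rightarrow> bool" where
  "meager_in X A \<longleftrightarrow> (\<exists>\<A>. countable \<A> \<and> (\<forall>N\<in>\<A>. nowhere_dense_in X N) \<and> A = \<Union>\<A>)"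

definition residual_in :: "'a topology \<Rightarrow> 'a set \<Rightarrow> bool" where
  "residual_in X A \<longleftrightarrow> A \<subseteq> topspace X \<and> meager_in X (topspace X - A)"

end

theory Submission
  imports Defs
begin

text \<open>
  The proof rests on an intrinsic description of the orbit \<open>O(L)\<close> of the backward shift. Let \<open>T\<close> be a
  real contraction such that the powers of \<open>T\<close> tend strongly to \<open>0\<close>, that \<open>T\<close> is co-isometric
  (\<open>T T* = I\<close>), and that the kernel of \<open>T\<close> is infinite-dimensional. If \<open>f 0, f 1, \<dots>\<close> is a real
  orthonormal basis of the kernel, then the vectors \<open>(T*)^j (f n)\<close> form a real orthonormal basis of
  the whole space, on which \<open>T\<close> acts as the backward shift. This is the Wold decomposition of the
  isometry \<open>T*\<close>, and it puts \<open>T\<close> into \<open>O(L)\<close> (lemma \<open>Wold_backward_shift\<close>). Since \<open>I - T* T\<close> is the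
  projection onto the kernel, the third property says that its trace, the sum over \<open>q\<close> of
  \<open>1 - \<parallel>T e_q\<parallel>^2\<close>, is infinite.

  In this form each property is a countable intersection of open conditions, because it is witnessed,
  up to a prescribed error, by finitely many vectors: some power \<open>T^n e_p\<close> is short; finitely many
  entries of the \<open>p\<close>-th row of \<open>T\<close> have a sum of squares close to \<open>1\<close>; finitely many \<open>q\<close> make the sum
  of \<open>1 - \<parallel>T e_q\<parallel>^2\<close> large. Each single condition is dense. For the first, \<open>T\<close> is approximated by \<open>r T\<close>
  with \<open>r < 1\<close>. For the third, \<open>T\<close> is composed with a projection \<open>P\<close> onto finitely many coordinates.
  For the second, a rank one operator that lives on a coordinate killed by \<open>P\<close> is added to \<open>T P\<close>; it
  can be chosen to complete the \<open>p\<close>-th row to length \<open>1\<close> while the sum stays a contraction (lemma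
  \<open>rank_one_completion\<close>). Hence \<open>O(L)\<close> is residual (lemma \<open>residual_orbit\<close>).

  For the embedding it suffices to embed one member of the orbit, because a semigroup can be conjugated
  by a real unitary operator (lemma \<open>orbit_embeddable\<close>). The left translations on \<open>L^2(0, \<infinity>)\<close> form a
  real contractive semigroup whose operator at time \<open>1\<close> has the three properties above, so it lies in
  the orbit. To have this semigroup on the sequence space itself, one needs vectors \<open>k s\<close> that play the
  role of the indicator functions of \<open>(0, s]\<close>: a total family with inner products \<open>min s t\<close>. They exist
  because this kernel is positive definite; Cholesky elimination with the positive rationals as
  pivots computes their coordinates (lemma \<open>Brownian_vectors\<close>). The semigroup is then determined by
  \<open>U t (k s) = k (s - t)\<close> (lemma \<open>translation_semigroup\<close>).
\<close>

section \<open>Inner product and coordinates\<close>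

definition basis :: "nat \<times> nat \<Rightarrow> ell2" where
  "basis p = unit_vec (fst p) (snd p)"

lemma coord_basis: "coord (basis p) q = (if q = p then 1 else 0)"
  by (simp add: basis_def unit_vec.rep_eq)

lemma coord_zero [simp]: "coord 0 p = 0"
  by (simp add: zero_ell2.rep_eq)

lemma coord_add: "coord (x + y) p = coord x p + coord y p"
  by (simp add: plus_ell2.rep_eq)

lemma coord_minus: "coord (- x) p = - coord x p"
  by (simp add: uminus_ell2.rep_eq)

lemma coord_diff: "coord (x - y) p = coord x p - coord y p"
  unfolding minus_ell2_def coord_add coord_minus by simp

lemma coord_scaleC: "coord (c *\<^sub>C x) p = c * coord x p"
  by (simp add: scaleC.rep_eq)

lemma coord_scaleR: "coord (r *\<^sub>R x) p = complex_of_real r * coord x p"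
  by (simp add: scaleR_ell2_def coord_scaleC)

lemma coord_sum: "coord (sum f F) p = (\<Sum>i\<in>F. coord (f i) p)"
  by (induction F rule: infinite_finite_induct) (simp_all add: coord_add)

lemmas coord_simps = coord_basis coord_add coord_minus coord_diff coord_scaleC coord_scaleR coord_sum

lemma scaleC_add_right: "c *\<^sub>C (x + y) = c *\<^sub>C x + c *\<^sub>C y"
  and scaleC_add_left: "(a + b) *\<^sub>C x = a *\<^sub>C x + b *\<^sub>C x"
  and scaleC_scaleC: "a *\<^sub>C b *\<^sub>C x = (a * b) *\<^sub>C x"
  and scaleC_one [simp]: "1 *\<^sub>C x = x"
  and scaleC_zero_left [simp]: "0 *\<^sub>C x = 0"
  and scaleC_zero_right [simp]: "c *\<^sub>C 0 = 0"
  by (rule ell2_eqI, simp add: coord_simps ring_distribs)+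

lemma norm_sq: "(norm x)\<^sup>2 = (\<Sum>\<^sub>\<infinity>p. (cmod (coord x p))\<^sup>2)"
  by (simp add: norm_ell2_def infsum_nonneg)

lemma norm_scaleC: "norm (c *\<^sub>C x) = cmod c * norm x"
  by (simp add: norm_ell2_def coord_scaleC norm_mult power_mult_distrib infsum_cmult_right
      square_summable_coord real_sqrt_mult)

lemma cinner_summable: "(\<lambda>p. coord x p * cnj (coord y p)) summable_on UNIV"
  by (rule abs_summable_summable[OF cinner_abs_summable])

lemma cinner_add_left: "cinner (x + y) z = cinner x z + cinner y z"
  unfolding cinner_def by (simp add: coord_simps ring_distribs infsum_add cinner_summable)

lemma cinner_scaleC_left: "cinner (c *\<^sub>C x) y = c * cinner x y"
  unfolding cinner_def by (simp add: coord_simps infsum_cmult_right cinner_summable mult.assoc)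

lemma cinner_commute: "cnj (cinner x y) = cinner y x"
  unfolding cinner_def
  by (subst infsum_cnj[symmetric]) (simp add: mult.commute)

lemma cinner_add_right: "cinner x (y + z) = cinner x y + cinner x z"
  by (metis cinner_add_left cinner_commute complex_cnj_add)

lemma cinner_scaleC_right: "cinner x (c *\<^sub>C y) = cnj c * cinner x y"
  by (metis cinner_scaleC_left cinner_commute complex_cnj_mult)

lemma cinner_scaleR_left: "cinner (r *\<^sub>R x) y = complex_of_real r * cinner x y"
  and cinner_scaleR_right: "cinner x (r *\<^sub>R y) = complex_of_real r * cinner x y"
  by (simp_all add: scaleR_ell2_def cinner_scaleC_left cinner_scaleC_right)

lemma cinner_zero_left [simp]: "cinner 0 y = 0"
  and cinner_zero_right [simp]: "cinner x 0 = 0"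
  by (simp_all add: cinner_def)

lemma cinner_diff_left: "cinner (x - y) z = cinner x z - cinner y z"
  using cinner_add_left[of "x - y" y z] by simp

lemma cinner_diff_right: "cinner x (y - z) = cinner x y - cinner x z"
  using cinner_add_right[of x "y - z" z] by simp

lemma cinner_sum_left: "cinner (\<Sum>i\<in>F. f i) y = (\<Sum>i\<in>F. cinner (f i) y)"
  by (induction F rule: infinite_finite_induct) (simp_all add: cinner_add_left)

lemma cinner_sum_right: "cinner y (\<Sum>i\<in>F. f i) = (\<Sum>i\<in>F. cinner y (f i))"
  by (induction F rule: infinite_finite_induct) (simp_all add: cinner_add_right)

lemmas cinner_simps = cinner_add_left cinner_add_right cinner_scaleC_left cinner_scaleC_right
  cinner_scaleR_left cinner_scaleR_right cinner_diff_left cinner_diff_right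
  cinner_sum_left cinner_sum_right

lemma cinner_basis_right: "cinner x (basis p) = coord x p"
proof -
  have "cinner x (basis p) = (\<Sum>\<^sub>\<infinity>q\<in>{p}. coord x q * cnj (coord (basis p) q))"
    unfolding cinner_def by (rule infsum_cong_neutral) (auto simp: coord_basis)
  then show ?thesis
    by (simp add: coord_basis)
qed

lemma cinner_basis_left: "cinner (basis p) x = cnj (coord x p)"
  by (metis cinner_basis_right cinner_commute)

lemma norm_sq_cinner: "(norm x)\<^sup>2 = Re (cinner x x)"
  by (simp add: cinner_self)

lemma norm_eq_1I:
  assumes "cinner x x = 1" shows "norm x = 1"
proof -
  have "(norm x)\<^sup>2 = 1"
    using assms by (simp add: norm_sq_cinner)
  then show ?thesis
    by (metis norm_ge_zero one_power2 power2_eq_imp_eq zero_le_one)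
qed

lemma norm_basis [simp]: "norm (basis p) = 1"
  by (rule norm_eq_1I) (simp add: cinner_basis_left coord_basis)

lemma norm_diff_scaleC_sq:
  "(norm (x - c *\<^sub>C y))\<^sup>2 = (norm x)\<^sup>2 - 2 * Re (cnj c * cinner x y) + (cmod c)\<^sup>2 * (norm y)\<^sup>2"
proof -
  have "Re (cinner (x - c *\<^sub>C y) (x - c *\<^sub>C y))
      = Re (cinner x x) - Re (cnj c * cinner x y) - Re (c * cinner y x)
        + Re (c * cnj c * cinner y y)"
    by (simp add: cinner_simps algebra_simps)
  moreover have "Re (c * cinner y x) = Re (cnj c * cinner x y)"
    by (subst cinner_commute[of x y, symmetric]) simp
  moreover have "Re (c * cnj c * cinner y y) = (cmod c)\<^sup>2 * (norm y)\<^sup>2"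
    by (simp add: cinner_self complex_norm_square[symmetric] flip: of_real_mult)
  ultimately show ?thesis
    by (simp add: norm_sq_cinner)
qed

lemma norm_add_sq: "(norm (x + y))\<^sup>2 = (norm x)\<^sup>2 + 2 * Re (cinner x y) + (norm y)\<^sup>2"
proof -
  have "x - (- 1) *\<^sub>C y = x + y"
    by (rule ell2_eqI) (simp add: coord_simps)
  with norm_diff_scaleC_sq[of x "-1" y] show ?thesis
    by (simp del: diff_minus_eq_add)
qed

lemma Cauchy_Schwarz_cinner: "cmod (cinner x y) \<le> norm x * norm y"
proof (cases "y = 0")
  case False
  define c where "c = cinner x y / complex_of_real ((norm y)\<^sup>2)"
  have ny: "norm y > 0"
    using False by simp
  have "Re (cnj c * cinner x y) = (cmod (cinner x y))\<^sup>2 / (norm y)\<^sup>2"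
    by (simp add: c_def mult.commute[of "cnj _"] complex_norm_square[symmetric] flip: of_real_divide of_real_power)
  moreover have "(cmod c)\<^sup>2 * (norm y)\<^sup>2 = (cmod (cinner x y))\<^sup>2 / (norm y)\<^sup>2"
    using ny by (simp add: c_def norm_divide norm_mult power2_eq_square)
  ultimately have "(norm x)\<^sup>2 - (cmod (cinner x y))\<^sup>2 / (norm y)\<^sup>2 \<ge> 0"
    using norm_diff_scaleC_sq[of x c y] zero_le_power2[of "norm (x - c *\<^sub>C y)"] by linarith
  then have "(cmod (cinner x y))\<^sup>2 \<le> (norm x * norm y)\<^sup>2"
    using ny by (simp add: field_simps)
  then show ?thesis
    by (rule power2_le_imp_le) simp
qed simp

lemma cmod_coord_le: "cmod (coord x p) \<le> norm x"
  using Cauchy_Schwarz_cinner[of x "basis p"] by (simp add: cinner_basis_right)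

lemma tendsto_cinner_left:
  assumes "X \<longlonglongrightarrow> x" shows "(\<lambda>n. cinner (X n) y) \<longlonglongrightarrow> cinner x y"
proof -
  have "(\<lambda>n. norm (X n - x) * norm y) \<longlonglongrightarrow> 0"
    using assms by (intro tendsto_mult_left_zero tendsto_norm_zero LIM_zero)
  then have "(\<lambda>n. cinner (X n) y - cinner x y) \<longlonglongrightarrow> 0"
    by (rule Lim_null_comparison[rotated])
      (simp add: cinner_diff_left[symmetric] Cauchy_Schwarz_cinner)
  then show ?thesis
    by (rule LIM_zero_cancel)
qed

section \<open>Complex-linear operators and truncation\<close>

lemma clinear_scaleC: "clinear T \<Longrightarrow> T (c *\<^sub>C x) = c *\<^sub>C T x" for T :: "ell2 \<Rightarrow>\<^sub>L ell2"
  by (simp add: clinear_def)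

lemma clinear_compose: "clinear S \<Longrightarrow> clinear T \<Longrightarrow> clinear (S o\<^sub>L T)"
  by (simp add: clinear_def)

lemma contractionD: "contraction T \<Longrightarrow> norm (T x) \<le> norm x" for T :: "ell2 \<Rightarrow>\<^sub>L ell2"
  unfolding contraction_def
  using norm_blinfun[of T x] mult_right_mono[of "norm T" 1 "norm x"] by auto

lemma contractionI: "(\<And>x. norm (T x) \<le> norm x) \<Longrightarrow> contraction T" for T :: "ell2 \<Rightarrow>\<^sub>L ell2"
  unfolding contraction_def by (rule norm_blinfun_bound) auto

lemma contraction_compose: "contraction S \<Longrightarrow> contraction T \<Longrightarrow> contraction (S o\<^sub>L T)"
  by (rule contractionI) (auto intro: order_trans dest: contractionD)

lemma contraction_funpow:
  fixes T :: "ell2 \<Rightarrow>\<^sub>L ell2"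
  shows "contraction T \<Longrightarrow> norm ((blinfun_apply T ^^ n) x) \<le> norm x"
  by (induction n) (auto intro: order_trans dest: contractionD)

lemma clinear_operator_exists:
  assumes "\<And>x y. f (x + y) = f x + f y" "\<And>c x. f (c *\<^sub>C x) = c *\<^sub>C f x"
    and "\<And>x. norm (f x) \<le> K * norm x"
  shows "\<exists>T. clinear T \<and> blinfun_apply T = f"
proof -
  have "bounded_linear f"
    by (rule bounded_linear_intro[where K = K]) (simp_all add: assms scaleR_ell2_def mult.commute)
  then have "blinfun_apply (Blinfun f) = f"
    by (rule bounded_linear_Blinfun_apply)
  then show ?thesis
    using assms(2) by (metis clinear_def)
qed

lift_definition restrict_coords :: "(nat \<times> nat) set \<Rightarrow> ell2 \<Rightarrow> ell2" is
  "\<lambda>F x p. if p \<in> F then x p else 0"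
  by (rule summable_on_comparison_test) auto

lemma coord_restrict: "coord (restrict_coords F x) p = (if p \<in> F then coord x p else 0)"
  by (simp add: restrict_coords.rep_eq)

lemma restrict_coords_finite:
  "finite F \<Longrightarrow> restrict_coords F x = (\<Sum>p\<in>F. coord x p *\<^sub>C basis p)"
  by (rule ell2_eqI) (simp add: coord_restrict coord_simps if_distrib[of "\<lambda>z. _ * z"] cong: if_cong)

lemma norm_restrict_coords: "(norm (restrict_coords F x))\<^sup>2 = (\<Sum>\<^sub>\<infinity>p\<in>F. (cmod (coord x p))\<^sup>2)"
  unfolding norm_sq by (rule infsum_cong_neutral) (auto simp: coord_restrict)

definition square :: "nat \<Rightarrow> (nat \<times> nat) set" where
  "square N = {..<N} \<times> {..<N}"

lemma finite_square [simp]: "finite (square N)"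
  by (simp add: square_def)

lemma eventually_subset_square:
  assumes "finite F" shows "eventually (\<lambda>N. F \<subseteq> square N) sequentially"
proof -
  obtain M where M: "\<forall>p\<in>F. fst p < M \<and> snd p < M"
  proof
    show "\<forall>p\<in>F. fst p < Suc (\<Sum>q\<in>F. fst q + snd q) \<and> snd p < Suc (\<Sum>q\<in>F. fst q + snd q)"
      using member_le_sum[of _ F "\<lambda>q. fst q + snd q"] assms by fastforce
  qed
  show ?thesis
    unfolding eventually_sequentially square_def using M by (intro exI[of _ M]) fastforce
qed

definition trunc :: "nat \<Rightarrow> ell2 \<Rightarrow> ell2" where
  "trunc N = restrict_coords (square N)"

lemma trunc_sum: "trunc N x = (\<Sum>p\<in>square N. coord x p *\<^sub>C basis p)"
  by (simp add: trunc_def restrict_coords_finite)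

lemma norm_trunc_le: "norm (trunc N x) \<le> norm x"
proof (rule power2_le_imp_le)
  show "(norm (trunc N x))\<^sup>2 \<le> (norm x)\<^sup>2"
    unfolding trunc_def norm_restrict_coords unfolding norm_sq
    by (intro infsum_mono2 square_summable_coord) auto
qed simp

lemma trunc_tendsto: "(\<lambda>N. trunc N x) \<longlonglongrightarrow> x"
proof -
  have eq: "(norm (x - trunc N x))\<^sup>2
      = (norm x)\<^sup>2 - (\<Sum>p\<in>square N. (cmod (coord x p))\<^sup>2)" for N
  proof -
    have "x - trunc N x = restrict_coords (- square N) x"
      by (rule ell2_eqI) (simp add: trunc_def coord_simps coord_restrict)
    then have "(norm (x - trunc N x))\<^sup>2 = (\<Sum>\<^sub>\<infinity>p\<in>UNIV - square N. (cmod (coord x p))\<^sup>2)"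
      by (simp add: norm_restrict_coords Compl_eq_Diff_UNIV)
    also have "\<dots> = (norm x)\<^sup>2 - (\<Sum>\<^sub>\<infinity>p\<in>square N. (cmod (coord x p))\<^sup>2)"
      unfolding norm_sq by (rule infsum_Diff) (auto intro: square_summable_coord)
    finally show ?thesis by simp
  qed
  have "((\<lambda>p. (cmod (coord x p))\<^sup>2) has_sum (norm x)\<^sup>2) UNIV"
    unfolding norm_sq by (rule has_sum_infsum[OF square_summable_coord])
  then have lim: "((\<lambda>F. \<Sum>p\<in>F. (cmod (coord x p))\<^sup>2) \<longlongrightarrow> (norm x)\<^sup>2) (finite_subsets_at_top UNIV)"
    by (simp add: has_sum_def)
  have "filterlim square (finite_subsets_at_top UNIV) sequentially"
    unfolding filterlim_finite_subsets_at_top using eventually_subset_square by simp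
  from filterlim_compose[OF lim this]
  have "(\<lambda>N. (norm (x - trunc N x))\<^sup>2) \<longlonglongrightarrow> (norm x)\<^sup>2 - (norm x)\<^sup>2"
    unfolding eq by (intro tendsto_diff tendsto_const)
  then have "(\<lambda>N. norm (x - trunc N x)) \<longlonglongrightarrow> 0"
    using tendsto_real_sqrt by fastforce
  then have "(\<lambda>N. x - trunc N x) \<longlonglongrightarrow> 0"
    by (rule tendsto_norm_zero_cancel)
  then have "(\<lambda>N. x - (x - trunc N x)) \<longlonglongrightarrow> x - 0"
    by (intro tendsto_diff tendsto_const)
  then show ?thesis
    by simp
qed

text \<open>
  Finite combinations of basis vectors are dense, so a property passes to all vectors once it is
  linear and closed under limits.
\<close>

lemma ell2_dense_induct:
  assumes "\<And>p. P (basis p)" "\<And>x y. P x \<Longrightarrow> P y \<Longrightarrow> P (x + y)" "\<And>c x. P x \<Longrightarrow> P (c *\<^sub>C x)"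
    and lim: "\<And>X x. (\<And>n. P (X n)) \<Longrightarrow> X \<longlonglongrightarrow> x \<Longrightarrow> P x"
  shows "P x"
proof -
  have P0: "P 0"
    using assms(3)[OF assms(1), of 0] by simp
  have fin: "P (\<Sum>p\<in>F. coord x p *\<^sub>C basis p)" if "finite F" for F
    using that
  proof (induction F rule: finite_induct)
    case (insert p F)
    then show ?case
      by (simp add: assms(2) assms(3)[OF assms(1)])
  qed (simp add: P0)
  show ?thesis
    by (rule lim[OF _ trunc_tendsto]) (simp add: trunc_sum fin)
qed

lemma clinear_eqI:
  fixes S T :: "ell2 \<Rightarrow>\<^sub>L ell2"
  assumes "clinear S" "clinear T" "\<And>p. S (basis p) = T (basis p)"
  shows "S = T"
proof (rule blinfun_eqI)
  show "S x = T x" for x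
  proof (induction x rule: ell2_dense_induct)
    case (4 X x)
    have "(\<lambda>n. S (X n)) \<longlonglongrightarrow> S x" "(\<lambda>n. T (X n)) \<longlonglongrightarrow> T x"
      by (intro blinfun.tendsto tendsto_const 4(2))+
    then show ?case
      using 4(1) LIMSEQ_unique by simp
  qed (auto simp: assms blinfun.add_right clinear_scaleC)
qed

lemma trunc_operator: "\<exists>P. real_operator P \<and> contraction P \<and> blinfun_apply P = trunc N"
proof -
  have "\<exists>P. clinear P \<and> blinfun_apply P = trunc N"
  proof (rule clinear_operator_exists)
    show "norm (trunc N x) \<le> 1 * norm x" for x
      by (simp add: norm_trunc_le)
  qed (auto simp: trunc_def coord_restrict coord_simps intro!: ell2_eqI)
  then obtain P where "clinear P" "blinfun_apply P = trunc N"
    by blast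
  moreover have "real_operator P"
    using calculation by (auto simp: real_operator_def real_seqs_def trunc_def coord_restrict)
  moreover have "contraction P"
    using calculation by (intro contractionI) (simp add: norm_trunc_le)
  ultimately show ?thesis by blast
qed

section \<open>Bessel families and adjoints\<close>

text \<open>
  A bound on finite combinations of a family \<open>g\<close> dualizes to Bessel's inequality: test \<open>x\<close> against
  the combination of the \<open>g p\<close> with coefficients \<open>cinner x (g p)\<close>. This one construction yields
  adjoints (\<open>g p = T (basis p)\<close>), the unitary operators attached to complete orthonormal families, and
  the translation semigroup.
\<close>

lemma analysis_operator_exists:
  assumes K: "K \<ge> 0"
    and bessel: "\<And>F c. finite F \<Longrightarrow>
      (norm (\<Sum>p\<in>F. c p *\<^sub>C g p))\<^sup>2 \<le> K\<^sup>2 * (\<Sum>p\<in>F. (cmod (c p))\<^sup>2)"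
  shows "\<exists>A. clinear A \<and> (\<forall>x p. coord (A x) p = cinner x (g p)) \<and> (\<forall>x. norm (A x) \<le> K * norm x)"
proof -
  have fin: "(\<Sum>p\<in>F. (cmod (cinner x (g p)))\<^sup>2) \<le> (K * norm x)\<^sup>2" if F: "finite F" for x F
  proof -
    define s where "s = (\<Sum>p\<in>F. (cmod (cinner x (g p)))\<^sup>2)"
    define z where "z = (\<Sum>p\<in>F. cinner x (g p) *\<^sub>C g p)"
    have s0: "s \<ge> 0"
      by (simp add: s_def sum_nonneg)
    have nz: "(norm z)\<^sup>2 \<le> K\<^sup>2 * s"
      unfolding z_def s_def by (rule bessel[OF F])
    have "cinner x z = complex_of_real s"
      by (simp add: z_def s_def cinner_simps complex_norm_square mult.commute del: of_real_power)
    then have "s \<le> norm x * norm z"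
      using Cauchy_Schwarz_cinner[of x z] s0 by simp
    then have "s\<^sup>2 \<le> (norm x)\<^sup>2 * (norm z)\<^sup>2"
      using s0 by (metis power_mono power_mult_distrib)
    also have "\<dots> \<le> (norm x)\<^sup>2 * (K\<^sup>2 * s)"
      by (intro mult_left_mono nz) simp
    finally have "s * s \<le> (K * norm x)\<^sup>2 * s"
      by (simp add: power2_eq_square mult_ac)
    then have "s \<le> (K * norm x)\<^sup>2"
      using s0 by (cases "s = 0") (auto dest: mult_right_le_imp_le)
    then show ?thesis
      by (simp add: s_def)
  qed
  have summ: "(\<lambda>p. (cmod (cinner x (g p)))\<^sup>2) summable_on UNIV" for x
    by (rule nonneg_bdd_above_summable_on) (auto intro!: bdd_aboveI2 fin)
  define f where "f x = Abs_ell2 (\<lambda>p. cinner x (g p))" for x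
  have f: "coord (f x) p = cinner x (g p)" for x p
    using summ by (simp add: f_def Abs_ell2_inverse)
  have bound: "norm (f x) \<le> K * norm x" for x
  proof (rule power2_le_imp_le)
    show "(norm (f x))\<^sup>2 \<le> (K * norm x)\<^sup>2"
      unfolding norm_sq f by (rule infsum_le_finite_sums[OF summ fin])
  qed (use K in simp)
  have "\<exists>A. clinear A \<and> blinfun_apply A = f"
    by (rule clinear_operator_exists[OF _ _ bound])
      (auto intro!: ell2_eqI simp: coord_simps f cinner_simps)
  then show ?thesis
    using f bound by metis
qed

lemma norm_sum_basis: "finite F \<Longrightarrow> (norm (\<Sum>p\<in>F. c p *\<^sub>C basis p))\<^sup>2 = (\<Sum>p\<in>F. (cmod (c p))\<^sup>2)"
  unfolding norm_sq
  by (subst infsum_cong_neutral[where T = F and g = "\<lambda>p. (cmod (c p))\<^sup>2"])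
    (auto simp: coord_simps if_distrib[of "\<lambda>z. _ * z"] cong: if_cong)

lemma adjoint_exists:
  fixes T :: "ell2 \<Rightarrow>\<^sub>L ell2"
  assumes T: "clinear T"
  shows "\<exists>A. clinear A \<and> (\<forall>x y. cinner (T x) y = cinner x (A y))"
proof -
  have "(norm (\<Sum>p\<in>F. c p *\<^sub>C T (basis p)))\<^sup>2 \<le> (norm T)\<^sup>2 * (\<Sum>p\<in>F. (cmod (c p))\<^sup>2)"
    if "finite F" for F c
  proof -
    have "norm (T (\<Sum>p\<in>F. c p *\<^sub>C basis p)) \<le> norm T * norm (\<Sum>p\<in>F. c p *\<^sub>C basis p)"
      by (rule norm_blinfun)
    then have "(norm (T (\<Sum>p\<in>F. c p *\<^sub>C basis p)))\<^sup>2
        \<le> (norm T)\<^sup>2 * (norm (\<Sum>p\<in>F. c p *\<^sub>C basis p))\<^sup>2"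
      by (metis norm_ge_zero power_mono power_mult_distrib)
    then show ?thesis
      by (simp add: norm_sum_basis[OF that] blinfun.sum_right clinear_scaleC[OF T])
  qed
  from analysis_operator_exists[OF norm_ge_zero this]
  obtain A where A: "clinear A" "\<And>x p. coord (A x) p = cinner x (T (basis p))"
    by blast
  have "cinner (T x) y = cinner x (A y)" for x y
  proof (induction x rule: ell2_dense_induct)
    case (1 p)
    show ?case
      using A(2)[of y p] by (metis cinner_basis_left cinner_commute)
  next
    case (4 X x)
    have "(\<lambda>n. T (X n)) \<longlonglongrightarrow> T x"
      by (intro blinfun.tendsto tendsto_const 4(2))
    from tendsto_cinner_left[OF this, of y] tendsto_cinner_left[OF 4(2), of "A y"] show ?case
      using 4(1) LIMSEQ_unique by simp
  qed (auto simp: blinfun.add_right clinear_scaleC[OF T] cinner_simps)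
  with A(1) show ?thesis by blast
qed

lemma clinear_inverseI:
  fixes S T :: "ell2 \<Rightarrow>\<^sub>L ell2"
  assumes "clinear S" "clinear T" "\<And>p. S (T (basis p)) = basis p"
  shows "S (T y) = y"
proof -
  have "S o\<^sub>L T = id_blinfun"
    by (rule clinear_eqI) (use assms clinear_compose in \<open>auto simp: clinear_def\<close>)
  then show ?thesis
    by (metis blinfun_apply_blinfun_compose blinfun_apply_id_blinfun id_apply)
qed

text \<open>
  Total on all bounded real-linear maps, but meaningful only for complex-linear ones: for the others
  no operator has the selecting property.
\<close>

definition adj :: "(ell2 \<Rightarrow>\<^sub>L ell2) \<Rightarrow> (ell2 \<Rightarrow>\<^sub>L ell2)" where
  "adj T = (SOME A. clinear A \<and> (\<forall>x y. cinner (T x) y = cinner x (A y)))"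

lemma clinear_adj: "clinear T \<Longrightarrow> clinear (adj T)"
  and cinner_adj: "clinear T \<Longrightarrow> cinner (T x) y = cinner x (adj T y)" for T :: "ell2 \<Rightarrow>\<^sub>L ell2"
  unfolding adj_def using someI_ex[OF adjoint_exists[of T]] by blast+

lemma cinner_adj_left: "clinear T \<Longrightarrow> cinner (adj T x) y = cinner x (T y)" for T :: "ell2 \<Rightarrow>\<^sub>L ell2"
  by (metis cinner_adj cinner_commute)

lemma coord_adj: "clinear T \<Longrightarrow> coord (adj T y) p = cinner y (T (basis p))" for T :: "ell2 \<Rightarrow>\<^sub>L ell2"
  by (metis cinner_adj_left cinner_basis_right)

lemma adj_adj:
  assumes "clinear T" shows "adj (adj T) = T"
proof (intro blinfun_eqI ell2_eqI)
  show "coord (adj (adj T) x) p = coord (T x) p" for x p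
    by (simp add: coord_adj clinear_adj assms cinner_adj[symmetric] cinner_basis_right)
qed

lemma contraction_adj:
  assumes T: "clinear T" "contraction T"
  shows "contraction (adj T)"
proof (rule contractionI)
  fix y
  have "(norm (adj T y))\<^sup>2 = Re (cinner y (T (adj T y)))"
    by (simp add: norm_sq_cinner cinner_adj_left T)
  also have "\<dots> \<le> norm y * norm (T (adj T y))"
    using complex_Re_le_cmod Cauchy_Schwarz_cinner order_trans by blast
  also have "\<dots> \<le> norm y * norm (adj T y)"
    by (intro mult_left_mono contractionD T) simp
  finally show "norm (adj T y) \<le> norm y"
    by (cases "adj T y = 0") (auto simp: power2_eq_square)
qed

lemma cinner_real_seqs: "x \<in> real_seqs \<Longrightarrow> y \<in> real_seqs \<Longrightarrow> cinner x y \<in> \<real>"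
proof -
  assume "x \<in> real_seqs" "y \<in> real_seqs"
  then have "cnj (coord x p) = coord x p" "cnj (coord y p) = coord y p" for p
    by (simp_all only: real_seqs_def Reals_cnj_iff mem_Collect_eq)
  then have "cinner x y = cinner y x"
    unfolding cinner_def by (simp add: mult.commute)
  then show ?thesis
    by (metis Reals_cnj_iff cinner_commute)
qed

lemma basis_real [simp]: "basis p \<in> real_seqs"
  by (simp add: real_seqs_def coord_basis)

lemma real_operatorD: "real_operator T \<Longrightarrow> clinear T"
  "real_operator T \<Longrightarrow> x \<in> real_seqs \<Longrightarrow> T x \<in> real_seqs" for T :: "ell2 \<Rightarrow>\<^sub>L ell2"
  by (auto simp: real_operator_def)

lemma real_operator_compose: "real_operator S \<Longrightarrow> real_operator T \<Longrightarrow> real_operator (S o\<^sub>L T)"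
  by (simp add: real_operator_def clinear_compose)

lemma real_seqsI: "(\<And>p. coord x p \<in> \<real>) \<Longrightarrow> x \<in> real_seqs"
  by (simp add: real_seqs_def)

lemma real_operator_adj: "real_operator T \<Longrightarrow> real_operator (adj T)"
  unfolding real_operator_def by (auto intro!: clinear_adj real_seqsI simp: coord_adj cinner_real_seqs)

lemma real_seqs_add: "x \<in> real_seqs \<Longrightarrow> y \<in> real_seqs \<Longrightarrow> x + y \<in> real_seqs"
  and real_seqs_diff: "x \<in> real_seqs \<Longrightarrow> y \<in> real_seqs \<Longrightarrow> x - y \<in> real_seqs"
  and real_seqs_scaleR: "x \<in> real_seqs \<Longrightarrow> r *\<^sub>R x \<in> real_seqs"
  and real_seqs_scaleC: "x \<in> real_seqs \<Longrightarrow> c \<in> \<real> \<Longrightarrow> c *\<^sub>C x \<in> real_seqs"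
  and real_seqs_zero: "0 \<in> real_seqs"
  by (auto simp: real_seqs_def coord_simps)

lemma real_seqs_sum: "(\<And>i. i \<in> F \<Longrightarrow> f i \<in> real_seqs) \<Longrightarrow> sum f F \<in> real_seqs"
  by (auto simp: real_seqs_def coord_simps intro!: sum_in_Reals)



section \<open>Complete real orthonormal families\<close>

lemma norm_sum_orthogonal:
  assumes "finite F" and "\<And>p. p \<in> F \<Longrightarrow> norm (g p) = 1"
    and "\<And>p q. p \<in> F \<Longrightarrow> q \<in> F \<Longrightarrow> p \<noteq> q \<Longrightarrow> cinner (g p) (g q) = 0"
  shows "(norm (\<Sum>p\<in>F. c p *\<^sub>C g p))\<^sup>2 = (\<Sum>p\<in>F. (cmod (c p))\<^sup>2)"
  using assms
proof (induction F rule: finite_induct)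
  case (insert p F)
  have "cinner (c p *\<^sub>C g p) (\<Sum>q\<in>F. c q *\<^sub>C g q) = 0"
    unfolding cinner_sum_right cinner_scaleC_left cinner_scaleC_right
    using insert by (intro sum.neutral) auto
  then show ?case
    using insert by (simp add: norm_add_sq norm_scaleC)
qed simp

text \<open>
  The analysis operator of a real orthonormal family is a real co-isometry, because its adjoint sends
  the basis vectors to the family.
\<close>

lemma orthonormal_analysis:
  assumes norm: "\<And>p. norm (g p) = 1"
    and orth: "\<And>p q. p \<noteq> q \<Longrightarrow> cinner (g p) (g q) = 0"
    and real: "\<And>p. g p \<in> real_seqs"
  shows "\<exists>S. real_operator S \<and> contraction S \<and> (\<forall>x p. coord (S x) p = cinner x (g p))
    \<and> (\<forall>p. adj S (basis p) = g p) \<and> (\<forall>y. S (adj S y) = y)"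
proof -
  have "(norm (\<Sum>p\<in>F. c p *\<^sub>C g p))\<^sup>2 \<le> 1\<^sup>2 * (\<Sum>p\<in>F. (cmod (c p))\<^sup>2)" if "finite F" for F c
    using norm_sum_orthogonal[OF that, of g c] norm orth by simp
  from analysis_operator_exists[OF _ this]
  obtain S where S: "clinear S" "\<And>x p. coord (S x) p = cinner x (g p)"
    "\<And>x. norm (S x) \<le> 1 * norm x"
    by auto
  have adjS: "adj S (basis p) = g p" for p
  proof (rule ell2_eqI)
    fix q
    have "coord (adj S (basis p)) q = cinner (basis p) (S (basis q))"
      by (rule coord_adj[OF S(1)])
    also have "\<dots> = cnj (cinner (basis q) (g p))"
      by (simp add: cinner_basis_left S(2))
    also have "\<dots> = coord (g p) q"
      by (simp add: cinner_commute cinner_basis_right)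
    finally show "coord (adj S (basis p)) q = coord (g p) q" .
  qed
  have "S (adj S y) = y" for y
  proof (rule clinear_inverseI)
    show "S (adj S (basis p)) = basis p" for p
      unfolding adjS by (rule ell2_eqI) (auto simp: S(2) coord_basis orth norm cinner_self)
  qed (simp_all add: S(1) clinear_adj)
  moreover have "real_operator S"
    unfolding real_operator_def using S(1)
    by (intro conjI ballI real_seqsI) (simp_all only: S(2) cinner_real_seqs real)
  moreover have "contraction S"
    using S(3) by (auto intro: contractionI)
  ultimately show ?thesis
    using S adjS by blast
qed

text \<open>
  Completeness makes the co-isometry of the preceding lemma injective. Injectivity turns \<open>S S* = I\<close>
  into \<open>S* S = I\<close>, because \<open>S\<close> annihilates \<open>S* S x - x\<close>.
\<close>

lemma complete_orthonormal_unitary: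
  assumes norm: "\<And>p. norm (g p) = 1"
    and orth: "\<And>p q. p \<noteq> q \<Longrightarrow> cinner (g p) (g q) = 0"
    and real: "\<And>p. g p \<in> real_seqs"
    and complete: "\<And>y. (\<And>p. cinner y (g p) = 0) \<Longrightarrow> y = 0"
  shows "\<exists>S. real_operator S \<and> unitary S \<and> (\<forall>x p. coord (S x) p = cinner x (g p))"
proof -
  obtain S where S: "real_operator S" "\<And>x p. coord (S x) p = cinner x (g p)"
    "\<And>y. S (adj S y) = y"
    using orthonormal_analysis[of g, OF norm orth real] by blast
  have cl: "clinear S"
    using S(1) by (simp add: real_operator_def)
  have left: "adj S (S x) = x" for x
  proof -
    have "cinner (adj S (S x) - x) (g p) = 0" for p
      using S(2)[of "adj S (S x)" p] S(2)[of x p] S(3)[of "S x"] by (simp add: cinner_diff_left)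
    then show ?thesis
      using complete by (metis right_minus_eq)
  qed
  have "unitary S"
    unfolding unitary_def using cl S(3) left by (metis cinner_adj surjI)
  then show ?thesis
    using S by blast
qed

lemma unitary_adj:
  fixes S :: "ell2 \<Rightarrow>\<^sub>L ell2"
  assumes S: "unitary S"
  shows "adj S (S x) = x" "S (adj S x) = x" "inv (blinfun_apply S) = blinfun_apply (adj S)"
proof -
  have cl: "clinear S"
    using S by (simp add: unitary_def)
  show left: "adj S (S x) = x" for x
    by (rule ell2_eqI) (use S in \<open>simp add: coord_adj[OF cl] unitary_def cinner_basis_right\<close>)
  show right: "S (adj S x) = x" for x
  proof -
    obtain z where "x = S z"
      using S by (metis unitary_def surjD)
    then show ?thesis
      by (simp add: left)
  qed
  show "inv (blinfun_apply S) = blinfun_apply (adj S)"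
    by (rule inv_equality) (simp_all add: left right)
qed

lemma unitary_norm:
  fixes S :: "ell2 \<Rightarrow>\<^sub>L ell2"
  assumes "unitary S" shows "norm (S x) = norm x"
proof -
  have "(norm (S x))\<^sup>2 = (norm x)\<^sup>2"
    using assms unfolding norm_sq_cinner unitary_def by simp
  then show ?thesis
    by simp
qed

lemma unitary_contraction: "unitary S \<Longrightarrow> contraction S"
  by (rule contractionI) (simp add: unitary_norm)

section \<open>Co-isometries with vanishing powers\<close>

definition coisometric :: "(ell2 \<Rightarrow>\<^sub>L ell2) \<Rightarrow> bool" where
  "coisometric T \<longleftrightarrow> (\<forall>x. T (adj T x) = x)"

text \<open>
  The trace of the defect operator \<open>I - T* T\<close> is infinite. For a co-isometry this operator is the
  projection onto the kernel, and its trace is the dimension of the kernel. Unlike that dimension, the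
  partial sums are continuous in the strong operator topology.
\<close>

definition infinite_defect :: "(ell2 \<Rightarrow>\<^sub>L ell2) \<Rightarrow> bool" where
  "infinite_defect T \<longleftrightarrow>
     (\<forall>k::nat. \<exists>F. finite F \<and> real k < (\<Sum>q\<in>F. 1 - (norm (T (basis q)))\<^sup>2))"

definition orthonormal :: "ell2 set \<Rightarrow> bool" where
  "orthonormal B \<longleftrightarrow> (\<forall>x\<in>B. norm x = 1) \<and> (\<forall>x\<in>B. \<forall>y\<in>B. x \<noteq> y \<longrightarrow> cinner x y = 0)"

text \<open>
  By Bessel's inequality the \<open>p\<close>-th coordinates of the members of \<open>B\<close> are square-summable, so only
  countably many members have a nonzero \<open>p\<close>-th coordinate.
\<close>

lemma orthonormal_countable:
  assumes B: "orthonormal B"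
  shows "countable B"
proof -
  have *: "countable {b \<in> B. (cmod (coord b p))\<^sup>2 \<noteq> 0}" for p
  proof (rule summable_countable_real)
    have "(\<Sum>b\<in>F. (cmod (coord b p))\<^sup>2) \<le> 1" if F: "finite F" "F \<subseteq> B" for F
    proof -
      define s where "s = (\<Sum>b\<in>F. (cmod (coord b p))\<^sup>2)"
      define z where "z = (\<Sum>b\<in>F. cnj (coord b p) *\<^sub>C b)"
      have "(norm z)\<^sup>2 = s"
        unfolding z_def s_def using norm_sum_orthogonal[of F "\<lambda>b. b" "\<lambda>b. cnj (coord b p)"] F B
        by (auto simp: orthonormal_def)
      moreover have "coord z p = complex_of_real s"
        by (simp add: z_def s_def coord_simps complex_norm_square mult.commute del: of_real_power)
      moreover have "cmod (coord z p) \<le> norm z"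
        by (rule cmod_coord_le)
      moreover have s0: "0 \<le> s"
        by (simp add: s_def sum_nonneg)
      ultimately have "s \<le> norm z" "(norm z)\<^sup>2 = s"
        by (simp_all del: of_real_sum)
      then have "s\<^sup>2 \<le> s"
        using s0 by (metis power_mono)
      then show ?thesis
        unfolding s_def[symmetric] using s0
        by (cases "s = 0") (auto simp: power2_eq_square)
    qed
    then show "(\<lambda>b. (cmod (coord b p))\<^sup>2) summable_on B"
      by (intro nonneg_bdd_above_summable_on) (auto intro!: bdd_aboveI2[where M = 1])
  qed
  have "B \<subseteq> (\<Union>p. {b \<in> B. (cmod (coord b p))\<^sup>2 \<noteq> 0})"
  proof
    fix b assume "b \<in> B"
    then have "b \<noteq> 0"
      using B by (auto simp: orthonormal_def)
    then have "\<exists>p. coord b p \<noteq> 0"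
      by (metis coord_zero ell2_eqI)
    with \<open>b \<in> B\<close> show "b \<in> (\<Union>p. {b \<in> B. (cmod (coord b p))\<^sup>2 \<noteq> 0})"
      by auto
  qed
  then show ?thesis
    by (rule countable_subset) (intro countable_UN * countableI_type)
qed

lemma real_imaginary_decomposition:
  "\<exists>a\<in>real_seqs. \<exists>b\<in>real_seqs. x = a + \<i> *\<^sub>C b"
proof -
  have s: "(\<lambda>p. (cmod (complex_of_real (Re (coord x p))))\<^sup>2) summable_on UNIV"
    "(\<lambda>p. (cmod (complex_of_real (Im (coord x p))))\<^sup>2) summable_on UNIV"
    by (rule summable_on_comparison_test[OF square_summable_coord[of x UNIV]];
        simp add: cmod_power2)+
  define a where "a = Abs_ell2 (\<lambda>p. complex_of_real (Re (coord x p)))"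
  define b where "b = Abs_ell2 (\<lambda>p. complex_of_real (Im (coord x p)))"
  have "coord a p = complex_of_real (Re (coord x p))" "coord b p = complex_of_real (Im (coord x p))" for p
    using s by (simp_all add: a_def b_def Abs_ell2_inverse)
  then have "a \<in> real_seqs" "b \<in> real_seqs" "x = a + \<i> *\<^sub>C b"
    by (auto intro!: real_seqsI ell2_eqI simp: coord_simps complex_eq)
  then show ?thesis by blast
qed

text \<open>
  Zorn's lemma provides a maximal orthonormal set of real vectors in the kernel. Maximality only
  excludes real vectors orthogonal to it; since \<open>T\<close> is real, a complex vector is treated through
  its real and imaginary parts.
\<close>

lemma kernel_orthonormal_basis:
  fixes T :: "ell2 \<Rightarrow>\<^sub>L ell2"
  assumes T: "real_operator T"
  shows "\<exists>B. orthonormal B \<and> B \<subseteq> real_seqs \<and> (\<forall>b\<in>B. T b = 0)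
    \<and> (\<forall>y. T y = 0 \<longrightarrow> (\<forall>b\<in>B. cinner y b = 0) \<longrightarrow> y = 0)"
proof -
  define K where "K = {x \<in> real_seqs. T x = 0}"
  have clT: "clinear T"
    using T by (simp add: real_operator_def)
  define \<A> where "\<A> = {B. orthonormal B \<and> B \<subseteq> K}"
  have "\<exists>B\<in>\<A>. \<forall>A\<in>\<A>. B \<subseteq> A \<longrightarrow> A = B"
  proof (rule subset_Zorn')
    fix \<C> assume chain: "subset.chain \<A> \<C>"
    then have sub: "\<And>B. B \<in> \<C> \<Longrightarrow> orthonormal B \<and> B \<subseteq> K"
      and total: "\<And>A B. A \<in> \<C> \<Longrightarrow> B \<in> \<C> \<Longrightarrow> A \<subseteq> B \<or> B \<subseteq> A"
      unfolding \<A>_def subset_chain_def by auto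
    have "cinner x y = 0" if xy: "x \<in> \<Union>\<C>" "y \<in> \<Union>\<C>" "x \<noteq> y" for x y
    proof -
      obtain B where "B \<in> \<C>" "x \<in> B" "y \<in> B"
        using xy(1,2) total by blast
      then show ?thesis
        using sub xy(3) by (auto simp: orthonormal_def)
    qed
    then show "\<Union>\<C> \<in> \<A>"
      using sub by (simp add: \<A>_def orthonormal_def Sup_le_iff)
  qed
  then obtain B where B: "orthonormal B" "B \<subseteq> K"
    and max: "\<And>A. orthonormal A \<Longrightarrow> A \<subseteq> K \<Longrightarrow> B \<subseteq> A \<Longrightarrow> A = B"
    by (auto simp: \<A>_def)
  have real: "y = 0" if y: "y \<in> K" "\<And>b. b \<in> B \<Longrightarrow> cinner y b = 0" for y
  proof (rule ccontr)
    assume "y \<noteq> 0"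
    define u where "u = (1 / norm y) *\<^sub>R y"
    have u: "norm u = 1" "\<And>b. b \<in> B \<Longrightarrow> cinner u b = 0"
      using \<open>y \<noteq> 0\<close> y(2) by (simp_all add: u_def cinner_simps)
    then have u': "\<And>b. b \<in> B \<Longrightarrow> cinner b u = 0"
      by (metis cinner_commute complex_cnj_zero)
    have "u \<in> K"
      using y(1) by (simp add: K_def u_def real_seqs_scaleR blinfun.scaleR_right)
    then have "insert u B = B"
      using B u u' by (intro max) (auto simp: orthonormal_def)
    then have "cinner u u = 0"
      using u(2) by blast
    with u(1) show False
      by (simp add: cinner_self)
  qed
  have "y = 0" if y: "T y = 0" "\<And>b. b \<in> B \<Longrightarrow> cinner y b = 0" for y
  proof -
    obtain a c where ac: "a \<in> real_seqs" "c \<in> real_seqs" "y = a + \<i> *\<^sub>C c"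
      using real_imaginary_decomposition by blast
    have split: "u = 0 \<and> v = 0" if "u \<in> \<real>" "v \<in> \<real>" "u + \<i> * v = 0" for u v :: complex
      using that by (auto simp: complex_eq_iff complex_is_Real_iff)
    have Tac: "T a \<in> real_seqs" "T c \<in> real_seqs"
      using T ac by (auto simp: real_operator_def)
    have "coord (T a) p = 0 \<and> coord (T c) p = 0" for p
    proof (rule split)
      have "coord (T y) p = 0"
        by (simp add: y(1))
      then show "coord (T a) p + \<i> * coord (T c) p = 0"
        by (simp add: ac(3) blinfun.add_right clinear_scaleC[OF clT] coord_simps)
    qed (use Tac in \<open>simp_all only: real_seqs_def mem_Collect_eq\<close>)
    then have "T a = 0" "T c = 0"
      by (auto intro!: ell2_eqI)
    moreover have "cinner a b = 0 \<and> cinner c b = 0" if "b \<in> B" for b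
    proof (rule split)
      show "cinner a b + \<i> * cinner c b = 0"
        using y(2)[OF that] by (simp add: ac(3) cinner_simps)
    qed (use that ac B in \<open>auto simp: K_def intro!: cinner_real_seqs\<close>)
    ultimately have "a = 0" "c = 0"
      using ac(1,2) by (auto intro!: real simp only: K_def mem_Collect_eq)
    then show ?thesis
      by (simp add: ac(3))
  qed
  then show ?thesis
    using B unfolding K_def by blast
qed

text \<open>
  If \<open>B\<close> were finite, the projection \<open>I - T* T\<close> onto the kernel would expand in \<open>B\<close>, and all partial
  sums of its trace would be at most \<open>card B\<close>.
\<close>

lemma infinite_defect_kernel:
  fixes T :: "ell2 \<Rightarrow>\<^sub>L ell2"
  assumes T: "clinear T" "coisometric T" "infinite_defect T"
    and B: "orthonormal B" "\<And>b. b \<in> B \<Longrightarrow> T b = 0"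
    and complete: "\<And>y. T y = 0 \<Longrightarrow> (\<And>b. b \<in> B \<Longrightarrow> cinner y b = 0) \<Longrightarrow> y = 0"
  shows "infinite B"
proof
  assume fin: "finite B"
  have defect: "1 - (norm (T (basis q)))\<^sup>2 = (\<Sum>b\<in>B. (cmod (coord b q))\<^sup>2)" for q
  proof -
    define w where "w = basis q - adj T (T (basis q))"
    define s where "s = (\<Sum>b\<in>B. cinner (basis q) b *\<^sub>C b)"
    have wb: "cinner w b = cinner (basis q) b" if "b \<in> B" for b
      using B(2)[OF that] by (simp add: w_def cinner_diff_left cinner_adj_left[OF T(1)])
    have sb: "cinner s b = cinner (basis q) b" if b: "b \<in> B" for b
    proof -
      have "cinner s b = (\<Sum>b'\<in>B. if b' = b then cinner (basis q) b else 0)"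
        unfolding s_def cinner_sum_left cinner_scaleC_left using B(1) b
        by (intro sum.cong) (auto simp: orthonormal_def cinner_self)
      then show ?thesis
        using fin b by simp
    qed
    have "w - s = 0"
    proof (rule complete)
      show "T (w - s) = 0"
        using T(2) B(2) by (simp add: w_def s_def coisometric_def blinfun.diff_right
            blinfun.sum_right clinear_scaleC[OF T(1)])
    qed (simp add: cinner_diff_left wb sb)
    then have ws: "w = s"
      by simp
    have "cinner w (basis q) = complex_of_real (1 - (norm (T (basis q)))\<^sup>2)"
      by (simp add: w_def cinner_diff_left cinner_adj_left[OF T(1)] cinner_self)
    moreover have "cinner s (basis q) = complex_of_real (\<Sum>b\<in>B. (cmod (coord b q))\<^sup>2)"
      unfolding s_def cinner_sum_left cinner_scaleC_left
      by (simp add: cinner_basis_left cinner_basis_right complex_norm_square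
          mult.commute del: of_real_power)
    ultimately show ?thesis
      unfolding ws by (simp only: of_real_eq_iff)
  qed
  have "(\<Sum>q\<in>F. 1 - (norm (T (basis q)))\<^sup>2) \<le> real (card B)" if F: "finite F" for F
  proof -
    have "(\<Sum>q\<in>F. (cmod (coord b q))\<^sup>2) \<le> 1" if "b \<in> B" for b
    proof -
      have "(\<Sum>q\<in>F. (cmod (coord b q))\<^sup>2) \<le> (norm b)\<^sup>2"
        unfolding norm_sq by (intro finite_sum_le_infsum square_summable_coord F) auto
      then show ?thesis
        using B(1) that by (simp add: orthonormal_def)
    qed
    then have "(\<Sum>b\<in>B. \<Sum>q\<in>F. (cmod (coord b q))\<^sup>2) \<le> (\<Sum>b\<in>B. 1)"
      by (rule sum_mono)
    then show ?thesis
      unfolding defect by (subst sum.swap) simp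
  qed
  moreover obtain F where "finite F" "real (card B) < (\<Sum>q\<in>F. 1 - (norm (T (basis q)))\<^sup>2)"
    using T(3) by (auto simp: infinite_defect_def)
  ultimately show False
    by fastforce
qed

text \<open>
  Wandering vectors: the kernel of \<open>T\<close> is the orthogonal complement of the range of the isometry \<open>T*\<close>.
  A vector orthogonal to all \<open>(T*)^j (f n)\<close> has iterates under \<open>T\<close> of constant norm, and must
  vanish because the iterates tend to \<open>0\<close>.
\<close>

lemma Wold_backward_shift:
  fixes T :: "ell2 \<Rightarrow>\<^sub>L ell2"
  assumes T: "real_operator T" "contraction T" "coisometric T" "infinite_defect T"
    and stable: "\<And>p. (\<lambda>n. (blinfun_apply T ^^ n) (basis p)) \<longlonglongrightarrow> 0"
  shows "T \<in> real_unitary_orbit backward_shift"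
proof -
  define V where "V = blinfun_apply (adj T)"
  have cl: "clinear T"
    using T by (simp add: real_operator_def)
  have TV: "T (V x) = x" for x
    using T(3) by (simp add: coisometric_def V_def)
  have adjT: "cinner (V x) y = cinner x (T y)" for x y
    by (simp add: V_def cinner_adj_left[OF cl])
  have adjTn: "cinner ((V ^^ n) x) y = cinner x ((blinfun_apply T ^^ n) y)" for n x y
  proof (induction n arbitrary: y)
    case (Suc n)
    then show ?case
      by (simp add: adjT) (simp add: funpow_swap1)
  qed simp
  have TnVn: "(blinfun_apply T ^^ n) ((V ^^ n) x) = x" for n x
  proof (induction n)
    case (Suc n)
    have "(blinfun_apply T ^^ Suc n) ((V ^^ Suc n) x)
        = (blinfun_apply T ^^ n) (T (V ((V ^^ n) x)))"
      by (simp add: funpow_Suc_right del: funpow.simps) (simp add: funpow_swap1)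
    with Suc show ?case
      by (simp only: TV)
  qed simp
  have realV: "(V ^^ n) x \<in> real_seqs" if "x \<in> real_seqs" for n x
    using that T(1) real_operator_adj[of T] by (induction n) (auto simp: V_def real_operator_def)
  have stable': "(\<lambda>n. (blinfun_apply T ^^ n) x) \<longlonglongrightarrow> 0" for x
  proof (induction x rule: ell2_dense_induct)
    case (2 x y)
    have "(blinfun_apply T ^^ n) (x + y) = (blinfun_apply T ^^ n) x + (blinfun_apply T ^^ n) y" for n
      by (induction n) (simp_all add: blinfun.add_right)
    then show ?case
      using tendsto_add[OF 2] by simp
  next
    case (3 c x)
    have "(blinfun_apply T ^^ n) (c *\<^sub>C x) = c *\<^sub>C (blinfun_apply T ^^ n) x" for n
      by (induction n) (simp_all add: clinear_scaleC[OF cl])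
    then have "norm ((blinfun_apply T ^^ n) (c *\<^sub>C x)) = cmod c * norm ((blinfun_apply T ^^ n) x)" for n
      by (simp add: norm_scaleC)
    then show ?case
      using tendsto_mult_right_zero[OF tendsto_norm_zero[OF 3], of "cmod c"]
      by (intro tendsto_norm_zero_cancel[of "\<lambda>n. (blinfun_apply T ^^ n) (c *\<^sub>C x)"]) simp
  next
    case (4 X x)
    show ?case
    proof (rule LIMSEQ_I)
      fix e :: real assume "e > 0"
      obtain m where m: "norm (X m - x) < e / 2"
        using LIMSEQ_D[OF 4(2), of "e / 2"] \<open>e > 0\<close> by auto
      obtain N where N: "\<And>n. n \<ge> N \<Longrightarrow> norm ((blinfun_apply T ^^ n) (X m)) < e / 2"
        using LIMSEQ_D[OF 4(1)[of m], of "e / 2"] \<open>e > 0\<close> by auto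
      have "norm ((blinfun_apply T ^^ n) x) < e" if "n \<ge> N" for n
      proof -
        have "(blinfun_apply T ^^ n) x = (blinfun_apply T ^^ n) (X m) - (blinfun_apply T ^^ n) (X m - x)"
          by (induction n) (simp_all add: blinfun.diff_right[symmetric])
        then have "norm ((blinfun_apply T ^^ n) x)
            \<le> norm ((blinfun_apply T ^^ n) (X m)) + norm ((blinfun_apply T ^^ n) (X m - x))"
          by (metis norm_triangle_ineq4)
        then show ?thesis
          using N[OF that] contraction_funpow[OF T(2), of n "X m - x"] m by linarith
      qed
      then show "\<exists>N. \<forall>n\<ge>N. norm ((blinfun_apply T ^^ n) x - 0) < e"
        by auto
    qed
  qed (rule stable)
  obtain B where B: "orthonormal B" "B \<subseteq> real_seqs" "\<And>b. b \<in> B \<Longrightarrow> T b = 0"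
    and complete: "\<And>y. T y = 0 \<Longrightarrow> (\<And>b. b \<in> B \<Longrightarrow> cinner y b = 0) \<Longrightarrow> y = 0"
    using kernel_orthonormal_basis[OF T(1)] by blast
  have "infinite B"
    using infinite_defect_kernel[OF cl T(3,4) B(1,3) complete] by blast
  moreover have "countable B"
    by (rule orthonormal_countable[OF B(1)])
  ultimately obtain f :: "nat \<Rightarrow> ell2" where f: "bij_betw f UNIV B"
    by (metis bij_betw_from_nat_into)
  have fB: "f n \<in> B" for n
    using f by (auto simp: bij_betw_def)
  have f_orth: "cinner (f m) (f n) = (if m = n then 1 else 0)" for m n
  proof (cases "m = n")
    case False
    then have "f m \<noteq> f n"
      using f by (metis UNIV_I bij_betw_def inj_on_def)
    with False fB B(1) show ?thesis
      by (auto simp: orthonormal_def)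
  qed (use fB B(1) in \<open>auto simp: orthonormal_def cinner_self\<close>)
  define g where "g p = (V ^^ fst p) (f (snd p))" for p
  have Tn_zero: "(blinfun_apply T ^^ Suc n) (f m) = 0" for n m
    by (induction n) (simp_all add: B(3)[OF fB])
  have g_orth: "cinner (g p) (g q) = (if p = q then 1 else 0)" for p q
  proof -
    have *: "cinner ((V ^^ i) (f m)) ((V ^^ j) (f n)) = (if i = j \<and> m = n then 1 else 0)"
      if le: "i \<le> j" for i j m n
    proof (cases "i = j")
      case True
      then show ?thesis
        by (simp add: adjTn TnVn f_orth)
    next
      case False
      then obtain d where d: "j = i + Suc d"
        using le less_iff_Suc_add[of i j] by auto
      have "cinner ((V ^^ j) (f n)) ((V ^^ i) (f m)) = cinner ((V ^^ i) ((V ^^ Suc d) (f n))) ((V ^^ i) (f m))"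
        unfolding d by (simp only: funpow_add o_apply)
      also have "\<dots> = cinner (f n) ((blinfun_apply T ^^ Suc d) (f m))"
        by (simp only: adjTn TnVn)
      also have "\<dots> = 0"
        by (simp only: Tn_zero cinner_zero_right)
      finally show ?thesis
        using False by (metis cinner_commute complex_cnj_zero)
    qed
    show ?thesis
    proof (cases "fst p \<le> fst q")
      case True
      then show ?thesis
        unfolding g_def by (simp add: * prod_eq_iff)
    next
      case False
      then have "cinner (g q) (g p) = 0"
        unfolding g_def by (simp add: *)
      then show ?thesis
        using False by (metis cinner_commute complex_cnj_zero linorder_linear)
    qed
  qed
  have "\<exists>S. real_operator S \<and> unitary S \<and> (\<forall>x p. coord (S x) p = cinner x (g p))"
  proof (rule complete_orthonormal_unitary)
    show "norm (g p) = 1" for p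
      by (rule norm_eq_1I) (simp add: g_orth)
    show "g p \<in> real_seqs" for p
      unfolding g_def using fB B(2) by (intro realV) auto
    fix y assume y: "\<And>p. cinner y (g p) = 0"
    \<comment> \<open>orthogonality to the \<open>n\<close>-th layer makes \<open>T^n y\<close> orthogonal to the kernel, where \<open>T\<close> is isometric\<close>
    have "norm ((blinfun_apply T ^^ n) y) = norm y" for n
    proof (induction n)
      case (Suc n)
      define z where "z = (blinfun_apply T ^^ n) y"
      have zf: "cinner z (f m) = 0" for m
      proof -
        have "cinner (f m) z = cinner (g (n, m)) y"
          by (simp add: z_def g_def adjTn)
        then show ?thesis
          using y by (metis cinner_commute complex_cnj_zero)
      qed
      have "z - V (T z) = 0"
      proof (rule complete)
        fix b assume "b \<in> B"
        then obtain m where "b = f m"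
          using f by (auto simp: bij_betw_def)
        then show "cinner (z - V (T z)) b = 0"
          by (simp add: cinner_diff_left zf adjT B(3)[OF fB])
      qed (simp add: blinfun.diff_right TV)
      then have "V (T z) = z"
        by simp
      then have "(norm (T z))\<^sup>2 = (norm z)\<^sup>2"
        by (metis adjT cinner_commute norm_sq_cinner)
      then show ?case
        using Suc by (simp add: z_def)
    qed simp
    then have "(\<lambda>n. norm ((blinfun_apply T ^^ n) y)) \<longlonglongrightarrow> norm y"
      by simp
    moreover have "(\<lambda>n. norm ((blinfun_apply T ^^ n) y)) \<longlonglongrightarrow> 0"
      by (rule tendsto_norm_zero[OF stable'])
    ultimately show "y = 0"
      using LIMSEQ_unique by force
  qed (simp add: g_orth)
  then obtain S where S: "real_operator S" "unitary S" "\<And>x p. coord (S x) p = cinner x (g p)"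
    by blast
  have "S (T x) = backward_shift (S x)" for x
  proof (rule ell2_eqI)
    fix p
    have "cinner (T x) (g p) = cinner x (V (g p))"
      by (metis adjT cinner_commute)
    also have "V (g p) = g (Suc (fst p), snd p)"
      by (simp add: g_def)
    finally show "coord (S (T x)) p = coord (backward_shift (S x)) p"
      by (simp add: S(3) backward_shift.rep_eq shift_fun.rep_eq case_prod_unfold)
  qed
  then have "blinfun_apply T = inv (blinfun_apply S) \<circ> blinfun_apply backward_shift \<circ> blinfun_apply S"
    by (auto simp: fun_eq_iff unitary_adj[OF S(2)] simp flip: \<open>\<And>x. S (T x) = _\<close>)
  then show ?thesis
    using S by (auto simp: real_unitary_orbit_def)
qed



section \<open>Residual sets in the strong operator topology\<close>

text \<open>
  A residual set is one that contains a countable intersection of open dense sets. The nowhere dense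
  sets must have exactly the complement of \<open>A\<close> as their union, hence the intersections with that complement.
\<close>

lemma residual_inI:
  assumes A: "A \<subseteq> topspace X" and count: "countable \<U>"
    and \<U>: "\<And>U. U \<in> \<U> \<Longrightarrow> openin X U \<and> X closure_of U = topspace X"
    and sub: "topspace X \<inter> \<Inter>\<U> \<subseteq> A"
  shows "residual_in X A"
proof -
  define \<A> where "\<A> = (\<lambda>U. topspace X - A - U) ` \<U>"
  have "nowhere_dense_in X N" if N: "N \<in> \<A>" for N
  proof -
    obtain U where U: "U \<in> \<U>" "N = topspace X - A - U"
      using N by (auto simp: \<A>_def)
    have "X closure_of N \<subseteq> X closure_of (topspace X - U)"
      by (intro closure_of_mono) (auto simp: U)
    also have "\<dots> = topspace X - U"
      using \<U>[OF U(1)] by (simp add: closure_of_complement interior_of_openin)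
    finally have "X interior_of (X closure_of N) \<subseteq> X interior_of (topspace X - U)"
      by (rule interior_of_mono)
    also have "\<dots> = {}"
      using \<U>[OF U(1)] by (simp add: interior_of_complement)
    finally show ?thesis
      by (auto simp: nowhere_dense_in_def U)
  qed
  moreover have "topspace X - A = \<Union>\<A>"
    using sub by (auto simp: \<A>_def)
  moreover have "countable \<A>"
    using count by (simp add: \<A>_def)
  ultimately show ?thesis
    using A by (auto simp: residual_in_def meager_in_def)
qed

lemma residual_in_superset:
  assumes "residual_in X A" "A \<subseteq> B" "B \<subseteq> topspace X"
  shows "residual_in X B"
proof -
  obtain \<A> where \<A>: "countable \<A>" "\<And>N. N \<in> \<A> \<Longrightarrow> nowhere_dense_in X N" "topspace X - A = \<Union>\<A>"
    using assms(1) by (auto simp: residual_in_def meager_in_def)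
  have "nowhere_dense_in X (N - B)" if "N \<in> \<A>" for N
  proof -
    have "X interior_of (X closure_of (N - B)) \<subseteq> X interior_of (X closure_of N)"
      by (intro interior_of_mono closure_of_mono) auto
    then show ?thesis
      using \<A>(2)[OF that] by (auto simp: nowhere_dense_in_def)
  qed
  moreover have "topspace X - B = \<Union>((\<lambda>N. N - B) ` \<A>)"
    using assms(2) \<A>(3) by auto
  ultimately show ?thesis
    using assms(3) \<A>(1) unfolding residual_in_def meager_in_def
    by (intro conjI exI[of _ "(\<lambda>N. N - B) ` \<A>"]) auto
qed

lemma topspace_sot [simp]: "topspace sot_real_contractions = real_contractions"
  by (simp add: sot_real_contractions_def strong_operator_topology_topspace)

text \<open>
  Pointwise convergence is convergence in the product topology, whose pullback along
  \<open>blinfun_apply\<close> is the strong operator topology.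
\<close>

lemma sot_closure_of_sequence:
  fixes A :: "nat \<Rightarrow> ell2 \<Rightarrow>\<^sub>L ell2"
  assumes A: "\<And>n. A n \<in> U" and U: "U \<subseteq> real_contractions" and T: "T \<in> real_contractions"
    and lim: "\<And>x. (\<lambda>n. A n x) \<longlonglongrightarrow> T x"
  shows "T \<in> sot_real_contractions closure_of U"
proof -
  have lim': "(\<lambda>n. blinfun_apply (A n)) \<longlonglongrightarrow> blinfun_apply T"
  proof -
    have "limitin (product_topology (\<lambda>_. euclidean) UNIV) (\<lambda>n. blinfun_apply (A n)) (blinfun_apply T) sequentially"
      unfolding limitin_componentwise using lim by (simp add: limitin_canonical_iff)
    then show ?thesis
      by (simp add: euclidean_product_topology limitin_canonical_iff)
  qed
  show ?thesis
    unfolding in_closure_of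
  proof (intro conjI allI impI)
    fix W assume "T \<in> W \<and> openin sot_real_contractions W"
    then obtain W' where W': "open W'" "W = blinfun_apply -` W' \<inter> real_contractions" "T \<in> W"
      by (auto simp: sot_real_contractions_def openin_subtopology strong_operator_topology_def
          openin_pullback_topology)
    then have "\<forall>\<^sub>F n in sequentially. blinfun_apply (A n) \<in> W'"
      using lim' by (intro topological_tendstoD) auto
    then obtain n where "blinfun_apply (A n) \<in> W'"
      by (auto simp: eventually_sequentially)
    then show "\<exists>y. y \<in> U \<and> y \<in> W"
      using A[of n] U W'(2) by blast
  qed (use T in simp)
qed

lemma continuous_map_euclideanI:
  fixes f :: "'a \<Rightarrow> 'b::metric_space"
  assumes "\<And>x e. x \<in> topspace X \<Longrightarrow> e > 0 \<Longrightarrow>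
    \<exists>U. openin X U \<and> x \<in> U \<and> (\<forall>y\<in>U. dist (f y) (f x) < e)"
  shows "continuous_map X euclidean f"
  unfolding continuous_map
proof (intro conjI allI impI)
  fix V :: "'b set" assume "openin euclidean V"
  then have V: "open V" by simp
  show "openin X {x \<in> topspace X. f x \<in> V}"
  proof (subst openin_subopen, intro ballI)
    fix x assume x: "x \<in> {x \<in> topspace X. f x \<in> V}"
    obtain e where e: "e > 0" "\<And>y. dist y (f x) < e \<Longrightarrow> y \<in> V"
      using V x unfolding open_dist by auto
    obtain U where "openin X U" "x \<in> U" "\<forall>y\<in>U. dist (f y) (f x) < e"
      using assms[of x e] x e(1) by blast
    with e(2) show "\<exists>T. openin X T \<and> x \<in> T \<and> T \<subseteq> {x \<in> topspace X. f x \<in> V}"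
      using openin_subset by (intro exI[of _ U]) blast
  qed
qed simp

lemma continuous_map_sot_eval:
  "continuous_map sot_real_contractions euclidean (\<lambda>T. blinfun_apply T x)"
  unfolding sot_real_contractions_def
  by (intro continuous_map_from_subtopology strong_operator_topology_continuous_evaluation)

text \<open>
  Evaluation is jointly continuous on contractions, because \<open>S (f S) - T (f T)\<close> splits into
  \<open>S (f S - f T)\<close>, which is no longer than \<open>f S - f T\<close>, and \<open>(S - T) (f T)\<close>.
\<close>

lemma continuous_map_sot_apply:
  assumes f: "continuous_map sot_real_contractions euclidean f"
  shows "continuous_map sot_real_contractions euclidean (\<lambda>T. blinfun_apply T (f T))"
proof (rule continuous_map_euclideanI)
  fix T :: "ell2 \<Rightarrow>\<^sub>L ell2" and e :: real
  assume T: "T \<in> topspace sot_real_contractions" and e: "e > 0"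
  let ?X = sot_real_contractions
  define U where "U = {S \<in> topspace ?X. f S \<in> ball (f T) (e / 2)}
    \<inter> {S \<in> topspace ?X. S (f T) \<in> ball (T (f T)) (e / 2)}"
  have "openin ?X U"
    unfolding U_def
    by (intro openin_Int openin_continuous_map_preimage[OF f]
        openin_continuous_map_preimage[OF continuous_map_sot_eval]) auto
  moreover have "T \<in> U"
    using T e by (simp add: U_def)
  moreover have "dist (S (f S)) (T (f T)) < e" if S: "S \<in> U" for S
  proof -
    have "contraction S"
      using S by (auto simp: U_def real_contractions_def)
    then have "norm (S (f S - f T)) \<le> norm (f S - f T)"
      by (rule contractionD)
    moreover have "norm (f S - f T) < e / 2" "norm (S (f T) - T (f T)) < e / 2"
      using S by (auto simp: U_def dist_norm norm_minus_commute)
    moreover have "norm (S (f S) - T (f T)) \<le> norm (S (f S - f T)) + norm (S (f T) - T (f T))"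
      using norm_triangle_ineq[of "S (f S - f T)" "S (f T) - T (f T)"]
      by (simp add: blinfun.diff_right)
    ultimately show ?thesis
      unfolding dist_norm by linarith
  qed
  ultimately show "\<exists>U. openin ?X U \<and> T \<in> U \<and> (\<forall>S\<in>U. dist (S (f S)) (T (f T)) < e)"
    by blast
qed

lemma continuous_map_sot_funpow:
  "continuous_map sot_real_contractions euclidean (\<lambda>T. (blinfun_apply T ^^ n) x)"
  by (induction n) (simp_all add: continuous_map_sot_apply)

lemma openin_sot_greater:
  fixes h :: "'i \<Rightarrow> (ell2 \<Rightarrow>\<^sub>L ell2) \<Rightarrow> real"
  assumes "\<And>i. i \<in> I \<Longrightarrow> continuous_map sot_real_contractions euclideanreal (h i)"
  shows "openin sot_real_contractions {T \<in> real_contractions. \<exists>i\<in>I. r < h i T}"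
proof -
  have "openin sot_real_contractions {T \<in> topspace sot_real_contractions. h i T \<in> {r<..}}"
    if "i \<in> I" for i
    by (rule openin_continuous_map_preimage[OF assms[OF that]]) simp
  then have "openin sot_real_contractions
      (\<Union>i\<in>I. {T \<in> topspace sot_real_contractions. h i T \<in> {r<..}})"
    by (intro openin_clauses(3)) auto
  moreover have "(\<Union>i\<in>I. {T \<in> topspace sot_real_contractions. h i T \<in> {r<..}})
      = {T \<in> real_contractions. \<exists>i\<in>I. r < h i T}"
    by auto
  ultimately show ?thesis by simp
qed

lemma continuous_map_sot_compose:
  fixes h :: "ell2 \<Rightarrow> real"
  assumes "continuous_map sot_real_contractions euclidean f" "continuous_on UNIV h"
  shows "continuous_map sot_real_contractions euclideanreal (\<lambda>T. h (f T))"
  using continuous_map_compose[OF assms(1), of euclideanreal h] assms(2)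
  by (simp add: o_def)

lemma continuous_coord: "continuous_on UNIV (\<lambda>x. coord x p)"
proof (rule continuous_at_imp_continuous_on, rule ballI)
  fix x
  have "\<forall>e>0. \<exists>d>0. \<forall>y. dist y x < d \<longrightarrow> dist (coord y p) (coord x p) < e"
    using cmod_coord_le[of _ p] by (metis coord_diff dist_norm le_less_trans)
  then show "isCont (\<lambda>x. coord x p) x"
    by (simp add: continuous_at_eps_delta)
qed

section \<open>Open dense conditions that characterize the orbit\<close>

definition small_power :: "nat \<times> nat \<Rightarrow> nat \<Rightarrow> (ell2 \<Rightarrow>\<^sub>L ell2) set" where
  "small_power p k = {T \<in> real_contractions.
     \<exists>n. norm ((blinfun_apply T ^^ n) (basis p)) < 1 / real (Suc k)}"

definition long_row :: "nat \<times> nat \<Rightarrow> nat \<Rightarrow> (ell2 \<Rightarrow>\<^sub>L ell2) set" where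
  "long_row p k = {T \<in> real_contractions.
     \<exists>F. finite F \<and> 1 - 1 / real (Suc k) < (\<Sum>q\<in>F. (cmod (coord (T (basis q)) p))\<^sup>2)}"

definition large_defect :: "nat \<Rightarrow> (ell2 \<Rightarrow>\<^sub>L ell2) set" where
  "large_defect k = {T \<in> real_contractions.
     \<exists>F. finite F \<and> real k < (\<Sum>q\<in>F. 1 - (norm (T (basis q)))\<^sup>2)}"

lemma openin_small_power: "openin sot_real_contractions (small_power p k)"
proof -
  have "continuous_map sot_real_contractions euclideanreal
      (\<lambda>T. - norm ((blinfun_apply T ^^ n) (basis p)))" for n
    by (rule continuous_map_sot_compose[OF continuous_map_sot_funpow]) (intro continuous_intros)
  from openin_sot_greater[where I = UNIV and r = "- (1 / real (Suc k))", OF this]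
  show ?thesis
    by (simp add: small_power_def)
qed

lemma openin_long_row: "openin sot_real_contractions (long_row p k)"
proof -
  have "continuous_map sot_real_contractions euclideanreal
      (\<lambda>T. \<Sum>q\<in>F. (cmod (coord (T (basis q)) p))\<^sup>2)" if "F \<in> Collect finite" for F
    using that
    by (intro continuous_map_sum continuous_map_sot_compose[OF continuous_map_sot_eval])
      (auto intro!: continuous_intros continuous_coord)
  from openin_sot_greater[where I = "Collect finite" and r = "1 - 1 / real (Suc k)", OF this]
  show ?thesis
    by (simp add: long_row_def)
qed

lemma openin_large_defect: "openin sot_real_contractions (large_defect k)"
proof -
  have "continuous_map sot_real_contractions euclideanreal
      (\<lambda>T. \<Sum>q\<in>F. 1 - (norm (T (basis q)))\<^sup>2)" if "F \<in> Collect finite" for F :: "(nat \<times> nat) set"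
    using that
    by (intro continuous_map_sum continuous_map_sot_compose[OF continuous_map_sot_eval, where h = "\<lambda>x. 1 - (norm x)\<^sup>2"])
      (auto intro!: continuous_intros)
  from openin_sot_greater[where I = "Collect finite" and r = "real k", OF this]
  show ?thesis
    by (simp add: large_defect_def)
qed

lemma real_operator_scaleR: "real_operator T \<Longrightarrow> real_operator (r *\<^sub>R T)"
  unfolding real_operator_def clinear_def
  by (simp add: blinfun.scaleR_left real_seqs_scaleR) (simp add: scaleR_ell2_def scaleC_scaleC mult.commute)

lemma dense_small_power: "real_contractions \<subseteq> sot_real_contractions closure_of (small_power p k)"
proof
  fix T assume T: "T \<in> real_contractions"
  then have cT: "contraction T"
    by (simp add: real_contractions_def)
  define r where "r n = 1 - inverse (real (Suc n))" for n
  have r: "0 \<le> r n" "r n < 1" for n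
    by (simp_all add: r_def field_simps)
  have r_lim: "r \<longlonglongrightarrow> 1 - 0"
    unfolding r_def by (intro tendsto_diff tendsto_const LIMSEQ_inverse_real_of_nat)
  show "T \<in> sot_real_contractions closure_of (small_power p k)"
  proof (rule sot_closure_of_sequence)
    show "(\<lambda>n. (r n *\<^sub>R T) x) \<longlonglongrightarrow> T x" for x
      using tendsto_scaleR[OF r_lim tendsto_const, of "T x"] by (simp add: blinfun.scaleR_left)
    fix n
    have contr: "norm ((r n *\<^sub>R T) x) \<le> r n * norm x" for x
      using contractionD[OF cT, of x] r(1)[of n] by (simp add: blinfun.scaleR_left mult_left_mono)
    have pow: "norm ((blinfun_apply (r n *\<^sub>R T) ^^ m) x) \<le> r n ^ m * norm x" for m x
    proof (induction m)
      case (Suc m)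
      have "norm ((blinfun_apply (r n *\<^sub>R T) ^^ Suc m) x)
          \<le> r n * norm ((blinfun_apply (r n *\<^sub>R T) ^^ m) x)"
        using contr by simp
      also have "\<dots> \<le> r n * (r n ^ m * norm x)"
        by (intro mult_left_mono Suc r)
      finally show ?case by (simp add: mult.assoc)
    qed simp
    \<comment> \<open>the powers of \<open>r T\<close> decay geometrically\<close>
    obtain m where "r n ^ m < 1 / real (Suc k)"
      using real_arch_pow_inv[of "1 / real (Suc k)" "r n"] r by auto
    then have "norm ((blinfun_apply (r n *\<^sub>R T) ^^ m) (basis p)) < 1 / real (Suc k)"
      using pow[of m "basis p"] by simp
    moreover have "contraction (r n *\<^sub>R T)"
      using contr r[of n] by (intro contractionI) (metis less_eq_real_def mult_left_le_one_le norm_ge_zero order_trans)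
    ultimately show "r n *\<^sub>R T \<in> small_power p k"
      using T real_operator_scaleR by (auto simp: small_power_def real_contractions_def)
  qed (use T in \<open>auto simp: small_power_def\<close>)
qed

text \<open>
  Agreement on the first \<open>N\<close> by \<open>N\<close> coordinates forces strong convergence because all operators are
  contractions: the error at \<open>x\<close> is at most twice the distance of \<open>x\<close> to its truncation.
\<close>

lemma sot_closure_of_trunc:
  fixes A :: "nat \<Rightarrow> ell2 \<Rightarrow>\<^sub>L ell2"
  assumes A: "\<And>N. A N \<in> U" and U: "U \<subseteq> real_contractions" and T: "T \<in> real_contractions"
    and agree: "\<And>N x. A N (trunc N x) = T (trunc N x)"
  shows "T \<in> sot_real_contractions closure_of U"
proof (rule sot_closure_of_sequence[OF A U T])
  fix x
  have "norm (A N x - T x) \<le> 2 * norm (x - trunc N x)" for N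
  proof -
    have "A N x - T x = A N (x - trunc N x) - T (x - trunc N x)"
      by (simp add: blinfun.diff_right agree)
    then have "norm (A N x - T x) \<le> norm (A N (x - trunc N x)) + norm (T (x - trunc N x))"
      by (metis norm_triangle_ineq4)
    also have "\<dots> \<le> norm (x - trunc N x) + norm (x - trunc N x)"
      using A[of N] U T by (intro add_mono contractionD) (auto simp: real_contractions_def)
    finally show ?thesis by simp
  qed
  moreover have "(\<lambda>N. 2 * norm (x - trunc N x)) \<longlonglongrightarrow> 0"
    using tendsto_norm_zero[OF LIM_zero[OF trunc_tendsto[of x]]]
    by (intro tendsto_mult_right_zero) (subst norm_minus_commute)
  ultimately have "(\<lambda>N. blinfun_apply (A N) x - blinfun_apply T x) \<longlonglongrightarrow> 0"
    by (rule Lim_null_comparison[OF always_eventually[OF allI]])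
  then show "(\<lambda>N. blinfun_apply (A N) x) \<longlonglongrightarrow> blinfun_apply T x"
    by (rule LIM_zero_cancel)
qed

lemma trunc_trunc [simp]: "trunc N (trunc N x) = trunc N x"
  by (rule ell2_eqI) (simp add: trunc_def coord_restrict)

lemma trunc_basis_outside: "q \<notin> square N \<Longrightarrow> trunc N (basis q) = 0"
  by (rule ell2_eqI) (auto simp: trunc_def coord_restrict coord_basis)

lemma truncated_operator:
  fixes T :: "ell2 \<Rightarrow>\<^sub>L ell2"
  assumes "T \<in> real_contractions"
  shows "\<exists>A\<in>real_contractions. \<forall>x. A x = T (trunc N x)"
proof -
  obtain P where P: "real_operator P" "contraction P" "blinfun_apply P = trunc N"
    using trunc_operator by blast
  with assms show ?thesis
    by (intro bexI[of _ "T o\<^sub>L P"])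
      (auto simp: real_contractions_def real_operator_compose contraction_compose)
qed

lemma dense_large_defect: "real_contractions \<subseteq> sot_real_contractions closure_of (large_defect k)"
proof
  fix T assume T: "T \<in> real_contractions"
  obtain A where A: "A N \<in> real_contractions" "blinfun_apply (A N) x = T (trunc N x)" for N x
    using truncated_operator[OF T] by metis
  show "T \<in> sot_real_contractions closure_of (large_defect k)"
  proof (rule sot_closure_of_trunc[where A = A, OF _ _ T])
    fix N
    \<comment> \<open>\<open>k + 1\<close> basis vectors outside the truncation window, all annihilated\<close>
    define F where "F = (\<lambda>i. (N + i, 0::nat)) ` {..k}"
    have "card F = Suc k"
      unfolding F_def by (subst card_image) (auto simp: inj_on_def)
    moreover have "A N (basis q) = 0" if "q \<in> F" for q
    proof -
      have "q \<notin> square N"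
        using that by (auto simp: F_def square_def)
      then show ?thesis
        by (simp add: A trunc_basis_outside)
    qed
    ultimately have "(\<Sum>q\<in>F. 1 - (norm (A N (basis q)))\<^sup>2) = real (Suc k)"
      by simp
    then show "A N \<in> large_defect k"
      using A(1) unfolding large_defect_def
      by (intro CollectI conjI exI[of _ F]) (auto simp: F_def)
  qed (auto simp: A large_defect_def)
qed

lemma adjoint_row:
  fixes T :: "ell2 \<Rightarrow>\<^sub>L ell2"
  assumes "clinear T"
  shows "(norm (adj T (basis p)))\<^sup>2 = (\<Sum>\<^sub>\<infinity>q. (cmod (coord (T (basis q)) p))\<^sup>2)"
    and "(\<lambda>q. (cmod (coord (T (basis q)) p))\<^sup>2) summable_on UNIV"
proof -
  have eq: "cmod (coord (adj T (basis p)) q) = cmod (coord (T (basis q)) p)" for q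
    by (simp add: coord_adj[OF assms] cinner_basis_left)
  show "(norm (adj T (basis p)))\<^sup>2 = (\<Sum>\<^sub>\<infinity>q. (cmod (coord (T (basis q)) p))\<^sup>2)"
    unfolding norm_sq eq ..
  show "(\<lambda>q. (cmod (coord (T (basis q)) p))\<^sup>2) summable_on UNIV"
    using square_summable_coord[of "adj T (basis p)" UNIV] unfolding eq .
qed

lemma long_rowI:
  assumes T: "T \<in> real_contractions" and "norm (adj T (basis p)) = 1"
  shows "T \<in> long_row p k"
proof (rule ccontr)
  assume "T \<notin> long_row p k"
  then have "(\<Sum>q\<in>F. (cmod (coord (T (basis q)) p))\<^sup>2) \<le> 1 - 1 / real (Suc k)" if "finite F" for F
    using T that by (auto simp: long_row_def not_less)
  moreover have cl: "clinear T"
    using T by (simp add: real_contractions_def real_operator_def)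
  ultimately have "(\<Sum>\<^sub>\<infinity>q. (cmod (coord (T (basis q)) p))\<^sup>2) \<le> 1 - 1 / real (Suc k)"
    by (intro infsum_le_finite_sums adjoint_row) auto
  then show False
    using assms(2) adjoint_row(1)[OF cl, of p] by simp
qed

text \<open>
  The new column \<open>z\<close> may be any vector with \<open>\<bar>cinner y z\<bar>^2 \<le> \<parallel>y\<parallel>^2 - \<parallel>A* y\<parallel>^2\<close>, since \<open>\<parallel>A'* y\<parallel>^2\<close> is the sum of
  \<open>\<parallel>A* y\<parallel>^2\<close> and \<open>\<bar>cinner y z\<bar>^2\<close>. With \<open>D = I - A A*\<close>, a nonnegative operator, the choice
  \<open>z = D e_p / sqrt (cinner (D e_p) e_p)\<close> satisfies the bound by the Cauchy-Schwarz inequality for the form of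
  \<open>D\<close>, with equality at \<open>y = e_p\<close>; equality there is what makes the \<open>p\<close>-th row a unit vector.
\<close>

lemma rank_one_completion:
  fixes A :: "ell2 \<Rightarrow>\<^sub>L ell2"
  assumes A: "A \<in> real_contractions" and q: "A (basis q) = 0"
  shows "\<exists>A'\<in>real_contractions. (\<forall>x. coord x q = 0 \<longrightarrow> blinfun_apply A' x = A x) \<and> norm (adj A' (basis p)) = 1"
proof -
  have real: "real_operator A" and cl: "clinear A" and contr: "contraction A"
    using A by (auto simp: real_contractions_def real_operator_def)
  have contr': "norm (adj A y) \<le> norm y" for y
    by (rule contractionD[OF contraction_adj[OF cl contr]])
  define b where "b = basis p - A (adj A (basis p))"
  define \<beta> where "\<beta> = 1 - (norm (adj A (basis p)))\<^sup>2"
  have "\<beta> \<ge> 0"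
    using contr'[of "basis p"] by (simp add: \<beta>_def power_le_one)
  show ?thesis
  proof (cases "\<beta> = 0")
    case True
    then have "norm (adj A (basis p)) = 1"
      by (metis \<beta>_def eq_iff_diff_eq_0 norm_ge_zero one_power2 power2_eq_imp_eq zero_le_one)
    with A show ?thesis by blast
  next
    case False
    with \<open>\<beta> \<ge> 0\<close> have \<beta>: "\<beta> > 0"
      by simp
    define z where "z = (1 / sqrt \<beta>) *\<^sub>R b"
    have z_real: "z \<in> real_seqs"
      unfolding z_def b_def
      by (intro real_seqs_scaleR real_seqs_diff basis_real real_operatorD[OF real]
          real_operatorD[OF real_operator_adj[OF real]])
    have cs: "(cmod (cinner y b))\<^sup>2 \<le> \<beta> * ((norm y)\<^sup>2 - (norm (adj A y))\<^sup>2)" for y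
    proof -
      define c where "c = cinner y b"
      have c: "c = cinner y (basis p) - cinner (adj A y) (adj A (basis p))"
        by (simp add: c_def b_def cinner_diff_right cinner_adj_left[OF cl])
      \<comment> \<open>the minimizer \<open>d\<close> of the form of \<open>I - A A*\<close> at \<open>y - d e_p\<close> gives the Cauchy-Schwarz inequality\<close>
      define d where "d = c / complex_of_real \<beta>"
      have "(norm (adj A (y - d *\<^sub>C basis p)))\<^sup>2 \<le> (norm (y - d *\<^sub>C basis p))\<^sup>2"
        by (intro power_mono contr') simp
      moreover have "adj A (y - d *\<^sub>C basis p) = adj A y - d *\<^sub>C adj A (basis p)"
        by (simp add: blinfun.diff_right clinear_scaleC clinear_adj cl)
      ultimately have "0 \<le> ((norm y)\<^sup>2 - (norm (adj A y))\<^sup>2) - 2 * Re (cnj d * c) + (cmod d)\<^sup>2 * \<beta>"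
        by (simp add: norm_diff_scaleC_sq c \<beta>_def algebra_simps)
      moreover have "Re (cnj d * c) = (cmod c)\<^sup>2 / \<beta>"
      proof -
        have "cnj d * c = complex_of_real ((cmod c)\<^sup>2 / \<beta>)"
          by (simp add: d_def complex_norm_square mult.commute del: of_real_power)
        then show ?thesis
          by (metis Re_complex_of_real)
      qed
      moreover have "(cmod d)\<^sup>2 * \<beta> = (cmod c)\<^sup>2 / \<beta>"
        using \<beta> by (simp add: d_def norm_divide power2_eq_square)
      ultimately have "(cmod c)\<^sup>2 / \<beta> \<le> (norm y)\<^sup>2 - (norm (adj A y))\<^sup>2"
        by linarith
      then show ?thesis
        using \<beta> by (simp add: c_def field_simps)
    qed
    have zz: "(cmod (cinner y z))\<^sup>2 = (cmod (cinner y b))\<^sup>2 / \<beta>" for y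
      using \<beta> by (simp add: z_def cinner_simps norm_mult norm_divide power_mult_distrib power_divide)
    have "\<exists>A'. clinear A' \<and> blinfun_apply A' = (\<lambda>x. A x + coord x q *\<^sub>C z)"
    proof (rule clinear_operator_exists)
      show "norm (A x + coord x q *\<^sub>C z) \<le> (1 + norm z) * norm x" for x
        using norm_triangle_ineq[of "A x" "coord x q *\<^sub>C z"] contractionD[OF contr, of x]
          mult_right_mono[OF cmod_coord_le[of x q], of "norm z"]
        by (simp add: norm_scaleC algebra_simps)
    qed (simp_all add: blinfun.add_right clinear_scaleC[OF cl] coord_simps scaleC_add_left
        scaleC_add_right scaleC_scaleC)
    then obtain A' where A': "clinear A'" "\<And>x. A' x = A x + coord x q *\<^sub>C z"
      by metis
    have adjA': "adj A' y = adj A y + cinner y z *\<^sub>C basis q" for y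
      by (rule ell2_eqI) (simp add: coord_adj cl A' cinner_simps coord_simps)
    have norm_adj: "(norm (adj A' y))\<^sup>2 = (norm (adj A y))\<^sup>2 + (cmod (cinner y z))\<^sup>2" for y
      by (simp add: adjA' norm_add_sq cinner_simps cinner_adj_left[OF cl] q norm_scaleC)
    have "contraction (adj A')"
    proof (rule contractionI, rule power2_le_imp_le)
      show "(norm (adj A' y))\<^sup>2 \<le> (norm y)\<^sup>2" for y
        using cs[of y] \<beta> by (simp add: norm_adj zz field_simps)
    qed simp
    then have "contraction A'"
      using contraction_adj[of "adj A'"] adj_adj A'(1) clinear_adj by metis
    moreover have "real_operator A'"
      unfolding real_operator_def
    proof (intro conjI ballI A'(1))
      show "A' x \<in> real_seqs" if "x \<in> real_seqs" for x
      proof -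
        have "coord x q \<in> \<real>"
          using that by (simp only: real_seqs_def mem_Collect_eq)
        with that show ?thesis
          unfolding A'(2) by (intro real_seqs_add real_seqs_scaleC z_real real_operatorD(2)[OF real])
      qed
    qed
    moreover have "norm (adj A' (basis p)) = 1"
    proof -
      have "cinner (basis p) b = complex_of_real \<beta>"
        by (simp add: b_def \<beta>_def cinner_diff_right cinner_self flip: cinner_adj_left[OF cl])
      then have "(norm (adj A' (basis p)))\<^sup>2 = (norm (adj A (basis p)))\<^sup>2 + \<beta>"
        unfolding norm_adj zz using \<beta> by (simp add: power2_eq_square)
      then have "(norm (adj A' (basis p)))\<^sup>2 = 1"
        by (simp add: \<beta>_def)
      then show ?thesis
        by (metis norm_ge_zero one_power2 power2_eq_imp_eq zero_le_one)
    qed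
    ultimately show ?thesis
      by (auto simp: real_contractions_def A' intro!: bexI[of _ A'])
  qed
qed

lemma dense_long_row: "real_contractions \<subseteq> sot_real_contractions closure_of (long_row p k)"
proof
  fix T assume T: "T \<in> real_contractions"
  have "\<exists>A'\<in>real_contractions. (\<forall>x. blinfun_apply A' (trunc N x) = T (trunc N x)) \<and> norm (adj A' (basis p)) = 1" for N
  proof -
    obtain A where A: "A \<in> real_contractions" "\<And>x. blinfun_apply A x = T (trunc N x)"
      using truncated_operator[OF T] by metis
    \<comment> \<open>the coordinate \<open>(N, 0)\<close> lies just outside the truncation window\<close>
    have "A (basis (N, 0)) = 0"
      by (simp add: A(2) trunc_basis_outside square_def)
    from rank_one_completion[OF A(1) this, of p]
    obtain A' where A': "A' \<in> real_contractions" "\<And>x. coord x (N, 0) = 0 \<Longrightarrow> A' x = A x"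
      "norm (adj A' (basis p)) = 1"
      by blast
    have "coord (trunc N x) (N, 0) = 0" for x
      by (simp add: trunc_def coord_restrict square_def)
    then have "A' (trunc N x) = T (trunc N x)" for x
      by (simp add: A'(2) A(2))
    with A' show ?thesis by blast
  qed
  then obtain A where A: "A N \<in> real_contractions" "A N (trunc N x) = T (trunc N x)"
    "norm (adj (A N) (basis p)) = 1" for N x
    by metis
  show "T \<in> sot_real_contractions closure_of (long_row p k)"
    by (rule sot_closure_of_trunc[OF long_rowI[OF A(1,3)] _ T A(2)]) (auto simp: long_row_def)
qed

text \<open>
  If \<open>v = T* e_p\<close> has norm at least \<open>1\<close>, then \<open>\<parallel>T v - e_p\<parallel>^2 = \<parallel>T v\<parallel>^2 - 2 \<parallel>v\<parallel>^2 + 1\<close> is at most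
  \<open>1 - \<parallel>v\<parallel>^2\<close>, hence zero.
\<close>

lemma coisometricI:
  fixes T :: "ell2 \<Rightarrow>\<^sub>L ell2"
  assumes T: "clinear T" "contraction T" and row: "\<And>p. norm (adj T (basis p)) \<ge> 1"
  shows "coisometric T"
proof -
  have "T (adj T y) = y" for y
  proof (rule clinear_inverseI)
    fix p
    define v where "v = adj T (basis p)"
    have "(norm (T v - 1 *\<^sub>C basis p))\<^sup>2 = (norm (T v))\<^sup>2 - 2 * Re (cinner (T v) (basis p)) + 1"
      unfolding norm_diff_scaleC_sq by simp
    also have "cinner (T v) (basis p) = complex_of_real ((norm v)\<^sup>2)"
      by (simp add: cinner_adj[OF T(1)] v_def[symmetric] cinner_self)
    also have "(norm (T v))\<^sup>2 - 2 * Re (complex_of_real ((norm v)\<^sup>2)) + 1 \<le> 0"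
      using power_mono[OF contractionD[OF T(2), of v] norm_ge_zero, of 2] one_le_power[OF row[of p], of 2]
      unfolding v_def[symmetric] Re_complex_of_real by linarith
    finally show "T (adj T (basis p)) = basis p"
      by (simp add: v_def)
  qed (simp_all add: T(1) clinear_adj)
  then show ?thesis
    by (simp add: coisometric_def)
qed

lemma generic_in_orbit:
  assumes T: "T \<in> real_contractions" and small: "\<And>p k. T \<in> small_power p k"
    and row: "\<And>p k. T \<in> long_row p k" and defect: "\<And>k. T \<in> large_defect k"
  shows "T \<in> real_unitary_orbit backward_shift"
proof (rule Wold_backward_shift)
  show re: "real_operator T" and c: "contraction T"
    using T by (auto simp: real_contractions_def)
  then have cl: "clinear T"
    by (simp add: real_operator_def)
  show "infinite_defect T"
    using defect by (auto simp: infinite_defect_def large_defect_def)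
  show "coisometric T"
  proof (rule coisometricI[OF cl c])
    fix p
    have "1 - 1 / real (Suc k) \<le> (norm (adj T (basis p)))\<^sup>2" for k
    proof -
      obtain F where F: "finite F" "1 - 1 / real (Suc k) < (\<Sum>q\<in>F. (cmod (coord (T (basis q)) p))\<^sup>2)"
        using row[of p k] by (auto simp: long_row_def)
      note F(2)
      also have "(\<Sum>q\<in>F. (cmod (coord (T (basis q)) p))\<^sup>2) \<le> (norm (adj T (basis p)))\<^sup>2"
        unfolding adjoint_row(1)[OF cl]
        by (intro finite_sum_le_infsum adjoint_row(2)[OF cl] F) auto
      finally show ?thesis by simp
    qed
    moreover have "(\<lambda>k. 1 - 1 / real (Suc k)) \<longlonglongrightarrow> 1 - 0"
      using LIMSEQ_inverse_real_of_nat by (intro tendsto_diff tendsto_const) (simp add: inverse_eq_divide)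
    ultimately have "1 \<le> (norm (adj T (basis p)))\<^sup>2"
      using LIMSEQ_le_const2 by fastforce
    then show "1 \<le> norm (adj T (basis p))"
      by (metis norm_ge_zero one_power2 power2_le_imp_le)
  qed
  show "(\<lambda>n. (blinfun_apply T ^^ n) (basis p)) \<longlonglongrightarrow> 0" for p
  proof (rule LIMSEQ_I)
    fix e :: real assume "e > 0"
    then obtain k where k: "1 / real (Suc k) < e"
      using nat_approx_posE by blast
    obtain N where N: "norm ((blinfun_apply T ^^ N) (basis p)) < 1 / real (Suc k)"
      using small[of p k] by (auto simp: small_power_def)
    have "norm ((blinfun_apply T ^^ n) (basis p)) < e" if "n \<ge> N" for n
    proof -
      have "(blinfun_apply T ^^ n) (basis p) = (blinfun_apply T ^^ (n - N)) ((blinfun_apply T ^^ N) (basis p))"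
        using that by (simp flip: funpow_add[THEN fun_cong, unfolded o_apply])
      then show ?thesis
        using contraction_funpow[OF c, of "n - N" "(blinfun_apply T ^^ N) (basis p)"] N k by simp
    qed
    then show "\<exists>N. \<forall>n\<ge>N. norm ((blinfun_apply T ^^ n) (basis p) - 0) < e"
      by auto
  qed
qed

text \<open>
  The inverse of a unitary operator is only a function; as a bounded operator it is the adjoint.
\<close>

lemma orbit_conjugate:
  assumes "T \<in> real_unitary_orbit A"
  shows "\<exists>S. real_operator S \<and> unitary S \<and> T = adj S o\<^sub>L A o\<^sub>L S"
proof -
  obtain S where S: "real_operator S" "unitary S"
    "blinfun_apply T = inv (blinfun_apply S) \<circ> blinfun_apply A \<circ> blinfun_apply S"
    using assms by (auto simp: real_unitary_orbit_def)
  have "T = adj S o\<^sub>L A o\<^sub>L S"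
    by (rule blinfun_eqI) (simp add: S(3) unitary_adj[OF S(2)])
  with S show ?thesis by blast
qed

lemma orbit_subset_real_contractions:
  "real_unitary_orbit backward_shift \<subseteq> real_contractions"
proof
  fix T assume "T \<in> real_unitary_orbit backward_shift"
  then obtain S where S: "real_operator S" "unitary S" "T = adj S o\<^sub>L backward_shift o\<^sub>L S"
    using orbit_conjugate by blast
  have "real_operator backward_shift"
    by (auto simp: real_operator_def clinear_backward_shift real_seqs_def backward_shift.rep_eq
        shift_fun.rep_eq)
  moreover have "contraction backward_shift"
    by (rule contractionI) (simp add: backward_shift.rep_eq norm_shift_fun_le)
  moreover have "clinear S"
    using S(1) by (simp add: real_operator_def)
  ultimately show "T \<in> real_contractions"
    using S by (simp add: real_contractions_def real_operator_compose contraction_compose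
        real_operator_adj contraction_adj unitary_contraction)
qed

lemma residual_orbit: "residual_in sot_real_contractions (real_unitary_orbit backward_shift)"
proof (rule residual_inI)
  let ?\<U> = "range (\<lambda>(p, k). small_power p k) \<union> range (\<lambda>(p, k). long_row p k) \<union> range large_defect"
  show "countable ?\<U>"
    by (intro countable_Un countable_image countableI_type)
  show "openin sot_real_contractions U \<and> sot_real_contractions closure_of U = topspace sot_real_contractions"
    if "U \<in> ?\<U>" for U
  proof -
    have "openin sot_real_contractions U" "real_contractions \<subseteq> sot_real_contractions closure_of U"
      using that by (auto simp: openin_small_power openin_long_row openin_large_defect
          dense_small_power[THEN subsetD] dense_long_row[THEN subsetD] dense_large_defect[THEN subsetD])
    then show ?thesis
      using closure_of_subset_topspace[of sot_real_contractions U] by auto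
  qed
  show "topspace sot_real_contractions \<inter> \<Inter> ?\<U> \<subseteq> real_unitary_orbit backward_shift"
    by (auto intro!: generic_in_orbit)
qed (simp add: orbit_subset_real_contractions)



section \<open>Realizing positive definite kernels by successive pivots\<close>

definition pos_def_on :: "'a set \<Rightarrow> ('a \<Rightarrow> 'a \<Rightarrow> real) \<Rightarrow> bool" where
  "pos_def_on D g \<longleftrightarrow> (\<forall>F c. finite F \<longrightarrow> F \<subseteq> D \<longrightarrow> (\<exists>s\<in>F. c s \<noteq> 0) \<longrightarrow>
     0 < (\<Sum>s\<in>F. \<Sum>t\<in>F. c s * c t * g s t))"

text \<open>
  Gram-Schmidt orthogonalization carried out on a kernel alone. Its index set \<open>'a\<close> may be uncountable;
  only the countably many pivots \<open>q i\<close> are eliminated, so that every index gets a row of coordinates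
  while the pivots account for all coordinate directions.
\<close>

locale pivoted_kernel =
  fixes g :: "'a \<Rightarrow> 'a \<Rightarrow> real" and D :: "'a set" and q :: "nat \<Rightarrow> 'a"
  assumes sym: "g s t = g t s" and pos: "pos_def_on D g"
    and q_D: "q i \<in> D" and inj_q: "inj q"
begin

text \<open>
  Iterated Schur complements: \<open>residual k s t\<close> is the inner product of the components of \<open>s\<close> and \<open>t\<close>
  orthogonal to the first \<open>k\<close> pivots.
\<close>

primrec residual :: "nat \<Rightarrow> 'a \<Rightarrow> 'a \<Rightarrow> real" where
  "residual 0 = g"
| "residual (Suc k) = (\<lambda>s t. residual k s t
     - residual k s (q k) * residual k (q k) t / residual k (q k) (q k))"

lemma residual_sym: "residual k s t = residual k t s"
  by (induction k arbitrary: s t) (simp_all add: sym mult.commute)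

text \<open>
  A Schur complement is the minimum of the form over the coefficient of the eliminated index, attained
  at the coefficient \<open>- b / a\<close> below.
\<close>

lemma residual_pos:
  assumes "finite F" "F \<subseteq> D - q ` {..<k}" "\<exists>s\<in>F. c s \<noteq> 0"
  shows "0 < (\<Sum>s\<in>F. \<Sum>t\<in>F. c s * c t * residual k s t)"
  using assms
proof (induction k arbitrary: F c)
  case 0
  then show ?case
    using pos by (auto simp: pos_def_on_def)
next
  case (Suc k)
  define p where "p = q k"
  define a where "a = residual k p p"
  have p: "p \<in> D - q ` {..<k}"
    using q_D inj_q by (auto simp: p_def inj_def)
  have "0 < (\<Sum>s\<in>{p}. \<Sum>t\<in>{p}. (\<lambda>_. 1) s * (\<lambda>_. 1) t * residual k s t)"
    by (rule Suc.IH) (use p in auto)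
  then have a: "a > 0"
    by (simp add: a_def)
  have pF: "p \<notin> F"
    using Suc.prems(2) by (auto simp: p_def lessThan_Suc)
  define b where "b = (\<Sum>s\<in>F. c s * residual k s p)"
  define Q where "Q = (\<Sum>s\<in>F. \<Sum>t\<in>F. c s * c t * residual k s t)"
  \<comment> \<open>the coefficient at the pivot that minimizes the form of the previous residual\<close>
  define c' where "c' = c(p := - b / a)"
  have c': "c' s = c s" if "s \<in> F" for s
    using that pF by (auto simp: c'_def)
  have c'p: "c' p = - b / a"
    by (simp add: c'_def)
  have "0 < (\<Sum>s\<in>insert p F. \<Sum>t\<in>insert p F. c' s * c' t * residual k s t)"
  proof (rule Suc.IH)
    show "\<exists>s\<in>insert p F. c' s \<noteq> 0"
      using Suc.prems(3) c' by auto
  qed (use Suc.prems p in \<open>auto simp: lessThan_Suc\<close>)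
  also have "\<dots> = c' p * c' p * a + (\<Sum>t\<in>F. c' p * c' t * residual k p t)
      + ((\<Sum>s\<in>F. c' s * c' p * residual k s p) + (\<Sum>s\<in>F. \<Sum>t\<in>F. c' s * c' t * residual k s t))"
    using pF Suc.prems(1) by (simp add: sum.distrib a_def)
  also have "(\<Sum>s\<in>F. \<Sum>t\<in>F. c' s * c' t * residual k s t) = Q"
    unfolding Q_def by (intro sum.cong refl) (simp add: c')
  also have "(\<Sum>t\<in>F. c' p * c' t * residual k p t) = c' p * b"
    unfolding b_def sum_distrib_left
    by (intro sum.cong refl) (simp add: c' residual_sym[of k p] mult.assoc)
  also have "(\<Sum>s\<in>F. c' s * c' p * residual k s p) = c' p * b"
    unfolding b_def sum_distrib_left by (intro sum.cong refl) (simp add: c' mult_ac)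
  also have "c' p * c' p * a + c' p * b + (c' p * b + Q) = Q - b * b / a"
    using a by (simp add: c'p field_simps)
  also have "\<dots> = (\<Sum>s\<in>F. \<Sum>t\<in>F. c s * c t * residual (Suc k) s t)"
  proof -
    have "b * b / a = (\<Sum>s\<in>F. \<Sum>t\<in>F. c s * c t * (residual k s p * residual k p t / a))"
      unfolding b_def sum_product sum_divide_distrib
      by (intro sum.cong refl) (simp add: residual_sym[of k p])
    then show ?thesis
      by (simp add: Q_def sum_subtractf right_diff_distrib p_def[symmetric] a_def[symmetric])
  qed
  finally show ?case .
qed

lemma pivot_pos: "0 < residual k (q k) (q k)"
  using residual_pos[of "{q k}" k "\<lambda>_. 1"] q_D inj_q by (auto simp: inj_def)

lemma residual_pivot: "j < k \<Longrightarrow> residual k s (q j) = 0"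
proof (induction k arbitrary: s)
  case (Suc k)
  show ?case
  proof (cases "j = k")
    case True
    then show ?thesis
      using pivot_pos[of k] by simp
  next
    case False
    with Suc have "residual k s (q j) = 0" "residual k (q k) (q j) = 0"
      by auto
    then show ?thesis
      by simp
  qed
qed simp

lemma residual_nonneg:
  assumes "finite F" "F \<subseteq> D"
  shows "0 \<le> (\<Sum>s\<in>F. \<Sum>t\<in>F. c s * c t * residual k s t)"
proof -
  define G where "G = F - q ` {..<k}"
  have zero: "residual k s t = 0" if "s \<in> q ` {..<k} \<or> t \<in> q ` {..<k}" for s t
    using that by (auto simp: residual_pivot residual_sym[of k "q _" t])
  have "(\<Sum>s\<in>F. \<Sum>t\<in>F. c s * c t * residual k s t)
      = (\<Sum>s\<in>G. \<Sum>t\<in>F. c s * c t * residual k s t)"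
    using assms(1) by (intro sum.mono_neutral_right) (auto simp: G_def zero)
  also have "\<dots> = (\<Sum>s\<in>G. \<Sum>t\<in>G. c s * c t * residual k s t)"
    using assms(1) by (intro sum.cong refl sum.mono_neutral_right) (auto simp: G_def zero)
  also have "\<dots> \<ge> 0"
  proof (cases "\<exists>s\<in>G. c s \<noteq> 0")
    case True
    have "finite G" "G \<subseteq> D - q ` {..<k}"
      using assms by (auto simp: G_def)
    from residual_pos[OF this True] show ?thesis
      by simp
  next
    case False
    then have "(\<Sum>s\<in>G. \<Sum>t\<in>G. c s * c t * residual k s t) = 0"
      by (intro sum.neutral ballI) auto
    then show ?thesis
      by simp
  qed
  finally show ?thesis .
qed

definition chol :: "'a \<Rightarrow> nat \<Rightarrow> real" where
  "chol s k = residual k s (q k) / sqrt (residual k (q k) (q k))"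

lemma chol_expansion: "g s t = residual K s t + (\<Sum>k<K. chol s k * chol t k)"
proof (induction K)
  case (Suc K)
  have "sqrt (residual K (q K) (q K)) * sqrt (residual K (q K) (q K)) = residual K (q K) (q K)"
    using pivot_pos[of K] by simp
  then have "chol s K * chol t K = residual K s (q K) * residual K (q K) t / residual K (q K) (q K)"
    unfolding chol_def times_divide_times_eq by (simp only: residual_sym[of K t])
  then show ?case
    using Suc by simp
qed simp

lemma chol_square_sum: "s \<in> D \<Longrightarrow> (\<Sum>k<K. (chol s k)\<^sup>2) \<le> g s s"
  using chol_expansion[of s s K] residual_nonneg[of "{s}" "\<lambda>_. 1" K]
  by (simp add: power2_eq_square)

lemma chol_diff_square_sum:
  assumes "s \<in> D" "t \<in> D"
  shows "(\<Sum>k<K. (chol s k - chol t k)\<^sup>2) \<le> g s s - 2 * g s t + g t t"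
proof (cases "s = t")
  case False
  then have "0 \<le> residual K s s - 2 * residual K s t + residual K t t"
    using residual_nonneg[of "{s, t}" "\<lambda>u. if u = s then 1 else - 1" K] assms residual_sym[of K t s]
    by simp
  moreover have "(\<Sum>k<K. (chol s k - chol t k)\<^sup>2)
      = (\<Sum>k<K. chol s k * chol s k) - 2 * (\<Sum>k<K. chol s k * chol t k) + (\<Sum>k<K. chol t k * chol t k)"
    by (simp add: power2_eq_square algebra_simps sum.distrib sum_subtractf sum_distrib_left)
  ultimately show ?thesis
    using chol_expansion[of s s K] chol_expansion[of s t K] chol_expansion[of t t K] by linarith
qed simp

lemma chol_pivot_zero: "j < k \<Longrightarrow> chol (q j) k = 0"
  by (simp add: chol_def residual_sym[of k "q j"] residual_pivot)

lemma chol_pivot_pos: "0 < chol (q j) j"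
  using pivot_pos[of j] by (simp add: chol_def)

definition realize :: "'a \<Rightarrow> ell2" where
  "realize s = Abs_ell2 (\<lambda>p. complex_of_real (chol s (prod_encode p)))"

lemma sum_encode_le:
  fixes f :: "nat \<Rightarrow> real"
  assumes "\<And>k. 0 \<le> f k" "\<And>K. (\<Sum>k<K. f k) \<le> C" and F: "finite F"
  shows "(\<Sum>p\<in>F. f (prod_encode p)) \<le> C"
proof -
  obtain K where K: "prod_encode ` F \<subseteq> {..<K}"
    using finite_nat_iff_bounded[of "prod_encode ` F"] F by auto
  have "(\<Sum>p\<in>F. f (prod_encode p)) = (\<Sum>k\<in>prod_encode ` F. f k)"
    by (subst sum.reindex) (auto intro: inj_on_subset[OF inj_prod_encode])
  also have "\<dots> \<le> (\<Sum>k<K. f k)"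
    using K assms(1) by (intro sum_mono2) auto
  also have "\<dots> \<le> C"
    by (rule assms(2))
  finally show ?thesis .
qed

lemma coord_realize:
  assumes "s \<in> D"
  shows "coord (realize s) p = complex_of_real (chol s (prod_encode p))"
proof -
  have "(\<lambda>p. (cmod (complex_of_real (chol s (prod_encode p))))\<^sup>2) summable_on UNIV"
    using sum_encode_le[of "\<lambda>k. (chol s k)\<^sup>2" "g s s"] chol_square_sum[OF assms]
    by (intro nonneg_bdd_above_summable_on) (auto intro!: bdd_aboveI2)
  then show ?thesis
    by (simp add: realize_def Abs_ell2_inverse)
qed

lemma realize_real: "s \<in> D \<Longrightarrow> realize s \<in> real_seqs"
  by (rule real_seqsI) (simp add: coord_realize)

text \<open>
  The row of a pivot is finite, and the residual vanishes at eliminated pivots, so the expansion is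
  exact after finitely many steps.
\<close>

lemma cinner_realize_pivot:
  assumes s: "s \<in> D"
  shows "cinner (realize s) (realize (q j)) = complex_of_real (g s (q j))"
proof -
  let ?f = "\<lambda>k. chol s k * chol (q j) k"
  have "cinner (realize s) (realize (q j))
      = (\<Sum>\<^sub>\<infinity>p\<in>prod_decode ` {..<Suc j}. complex_of_real (?f (prod_encode p)))"
    unfolding cinner_def
  proof (rule infsum_cong_neutral)
    fix p assume "p \<in> UNIV - prod_decode ` {..<Suc j}"
    then have "j < prod_encode p"
      by (metis DiffD2 imageI lessThan_iff less_Suc_eq_le not_less prod_encode_inverse)
    then show "coord (realize s) p * cnj (coord (realize (q j)) p) = 0"
      by (simp add: coord_realize q_D chol_pivot_zero)
  qed (auto simp: coord_realize s q_D)
  also have "\<dots> = (\<Sum>p\<in>prod_decode ` {..<Suc j}. complex_of_real (?f (prod_encode p)))"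
    by simp
  also have "\<dots> = complex_of_real (\<Sum>k<Suc j. ?f k)"
    by (subst sum.reindex) (auto intro: inj_on_subset[OF inj_prod_decode])
  also have "(\<Sum>k<Suc j. ?f k) = g s (q j)"
    using chol_expansion[of s "q j" "Suc j"] residual_pivot[of j "Suc j" s] by simp
  finally show ?thesis .
qed

lemma norm_realize:
  assumes "s \<in> D"
  shows "(norm (realize s))\<^sup>2 \<le> g s s"
  unfolding norm_sq
  using sum_encode_le[of "\<lambda>k. (chol s k)\<^sup>2" "g s s"] chol_square_sum[OF assms]
  by (intro infsum_le_finite_sums square_summable_coord) (simp add: coord_realize assms)

lemma norm_realize_diff:
  assumes "s \<in> D" "t \<in> D"
  shows "(norm (realize s - realize t))\<^sup>2 \<le> g s s - 2 * g s t + g t t"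
  unfolding norm_sq
  using sum_encode_le[of "\<lambda>k. (chol s k - chol t k)\<^sup>2" "g s s - 2 * g s t + g t t"]
    chol_diff_square_sum[OF assms]
  by (intro infsum_le_finite_sums square_summable_coord)
    (simp add: coord_diff coord_realize assms del: of_real_diff flip: of_real_diff)

text \<open>
  The rows of the pivots form a lower triangular matrix with positive diagonal, which can be inverted
  row by row.
\<close>

lemma basis_in_span_pivots: "basis p \<in> span (realize ` range q)"
proof -
  have "basis (prod_decode n) \<in> span (realize ` range q)" for n
  proof (induction n rule: less_induct)
    case (less n)
    define r where "r = realize (q n) - (\<Sum>k<n. chol (q n) k *\<^sub>R basis (prod_decode k))"
    have "r \<in> span (realize ` range q)"
      unfolding r_def
      by (intro span_diff span_sum span_scale less span_base imageI rangeI) auto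
    moreover have "r = chol (q n) n *\<^sub>R basis (prod_decode n)"
    proof (rule ell2_eqI)
      fix p
      have *: "(\<Sum>k<n. complex_of_real (chol (q n) k) * (if p = prod_decode k then 1 else 0))
          = (if prod_encode p < n then complex_of_real (chol (q n) (prod_encode p)) else 0)"
      proof -
        have "(p = prod_decode k) = (k = prod_encode p)" for k
          by (metis prod_decode_inverse prod_encode_inverse)
        then show ?thesis
          by (simp add: if_distrib[of "\<lambda>z. _ * z"] cong: if_cong)
      qed
      consider "prod_encode p < n" | "prod_encode p = n" | "prod_encode p > n"
        by linarith
      then show "coord r p = coord (chol (q n) n *\<^sub>R basis (prod_decode n)) p"
      proof cases
        case 1
        then have "p \<noteq> prod_decode n"
          by auto
        with 1 show ?thesis
          unfolding r_def coord_diff coord_sum coord_scaleR coord_basis * by (simp add: coord_realize q_D)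
      next
        case 2
        then show ?thesis
          unfolding r_def coord_diff coord_sum coord_scaleR coord_basis * by (auto simp: coord_realize q_D)
      next
        case 3
        then have "p \<noteq> prod_decode n"
          by auto
        with 3 show ?thesis
          unfolding r_def coord_diff coord_sum coord_scaleR coord_basis *
          by (simp add: coord_realize q_D chol_pivot_zero)
      qed
    qed
    moreover have "basis (prod_decode n) = (1 / chol (q n) n) *\<^sub>R (chol (q n) n *\<^sub>R basis (prod_decode n))"
      using chol_pivot_pos[of n] by simp
    ultimately show ?case
      by (metis span_scale)
  qed
  then show ?thesis
    by (metis prod_encode_inverse)
qed

end

section \<open>Vectors with the covariance of Brownian motion\<close>

text \<open>
  Removing the smallest point \<open>a\<close> splits off the square \<open>(a - b) (sum of c)^2\<close> and leaves the same form with
  \<open>a\<close> in the place of \<open>b\<close>.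
\<close>

lemma min_form_pos:
  fixes F :: "real set"
  assumes "finite F" "\<And>s. s \<in> F \<Longrightarrow> b < s" "\<exists>s\<in>F. c s \<noteq> 0"
  shows "0 < (\<Sum>s\<in>F. \<Sum>t\<in>F. c s * c t * (min s t - b))"
  using assms
proof (induction F arbitrary: b rule: finite_linorder_min_induct)
  case (insert a F)
  have aF: "a \<notin> F"
    using insert by auto
  let ?G = "insert a F"
  have "(\<Sum>s\<in>?G. \<Sum>t\<in>?G. c s * c t * (min s t - b))
      = (\<Sum>s\<in>?G. \<Sum>t\<in>?G. c s * c t * (a - b)) + (\<Sum>s\<in>?G. \<Sum>t\<in>?G. c s * c t * (min s t - a))"
    by (simp only: sum.distrib[symmetric]) (simp add: algebra_simps)
  also have "(\<Sum>s\<in>?G. \<Sum>t\<in>?G. c s * c t * (a - b)) = (a - b) * (\<Sum>s\<in>?G. c s)\<^sup>2"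
    unfolding power2_eq_square sum_product
    unfolding sum_distrib_left by (intro sum.cong refl) (simp add: mult_ac)
  also have "(\<Sum>s\<in>?G. \<Sum>t\<in>?G. c s * c t * (min s t - a))
      = (\<Sum>s\<in>F. \<Sum>t\<in>?G. c s * c t * (min s t - a))"
    using insert.hyps aF
    by (intro sum.mono_neutral_right ballI sum.neutral) (auto simp: min_def less_imp_le)
  also have "\<dots> = (\<Sum>s\<in>F. \<Sum>t\<in>F. c s * c t * (min s t - a))"
    using insert.hyps aF
    by (intro sum.cong refl sum.mono_neutral_right ballI) (auto simp: min_def less_imp_le)
  finally have eq: "(\<Sum>s\<in>?G. \<Sum>t\<in>?G. c s * c t * (min s t - b))
      = (a - b) * (\<Sum>s\<in>?G. c s)\<^sup>2 + (\<Sum>s\<in>F. \<Sum>t\<in>F. c s * c t * (min s t - a))" .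
  have ab: "a - b > 0"
    using insert.prems(1)[of a] by simp
  show ?case
  proof (cases "\<exists>s\<in>F. c s \<noteq> 0")
    case True
    then have "0 < (\<Sum>s\<in>F. \<Sum>t\<in>F. c s * c t * (min s t - a))"
      using insert.hyps by (intro insert.IH) auto
    then show ?thesis
      unfolding eq using ab by (simp add: add_nonneg_pos)
  next
    case False
    then have c0: "\<And>s. s \<in> F \<Longrightarrow> c s = 0" and "c a \<noteq> 0"
      using insert.prems(2) by auto
    then show ?thesis
      unfolding eq using ab insert.hyps aF by simp
  qed
qed simp

text \<open>
  Inner products with rational pivots are exact. They extend to all positive reals by density, since
  the realized vectors satisfy \<open>\<parallel>k s - k t\<parallel>^2 \<le> \<bar>s - t\<bar>\<close>. Setting \<open>k s = 0\<close> for \<open>s \<le> 0\<close> lets translation be written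
  as \<open>k s \<mapsto> k (s - t)\<close> without case distinction.
\<close>

lemma Brownian_vectors:
  "\<exists>k :: real \<Rightarrow> ell2. (\<forall>s. k s \<in> real_seqs)
    \<and> (\<forall>s t. cinner (k s) (k t) = complex_of_real (max 0 (min s t)))
    \<and> (\<forall>p. basis p \<in> span (k ` {0<..}))"
proof -
  define R where "R = {r :: real. r \<in> \<rat> \<and> 0 < r}"
  have "infinite R"
  proof
    assume "finite R"
    moreover have "(\<lambda>n. real (Suc n)) ` UNIV \<subseteq> R"
      by (auto simp: R_def)
    ultimately have "finite (range (\<lambda>n. real (Suc n)))"
      by (rule finite_subset[rotated])
    then show False
      using range_inj_infinite[of "\<lambda>n. real (Suc n)"] by (auto simp: inj_def)
  qed
  moreover have "countable R"
    by (rule countable_subset[OF _ countable_rat]) (auto simp: R_def)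
  ultimately obtain q :: "nat \<Rightarrow> real" where q: "bij_betw q UNIV R"
    by (metis bij_betw_from_nat_into)
  interpret pivoted_kernel min "{0<..}" q
  proof
    show "pos_def_on {0<..} (min :: real \<Rightarrow> real \<Rightarrow> real)"
      using min_form_pos[of _ 0] by (auto simp: pos_def_on_def subset_iff)
    show "q i \<in> {0<..}" for i
      using q by (auto simp: bij_betw_def R_def)
    show "inj q"
      using q by (auto simp: bij_betw_def)
  qed (rule min.commute)
  have cinner_realize: "cinner (realize s) (realize t) = complex_of_real (min s t)"
    if s: "s > 0" and t: "t > 0" for s t
  proof -
    have "cmod (cinner (realize s) (realize t) - complex_of_real (min s t)) \<le> e" if e: "e > 0" for e
    proof -
      \<comment> \<open>the first bound controls \<open>min s r - min s t\<close>, the second the Cauchy-Schwarz estimate \<open>sqrt s * sqrt \<delta>\<close>\<close>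
      define \<delta> where "\<delta> = min (e / 2) ((e / (2 * sqrt s + 2))\<^sup>2)"
      have \<delta>: "\<delta> > 0"
        using e s by (simp add: \<delta>_def) (metis add_pos_pos less_numeral_extra(3) real_sqrt_gt_zero zero_less_numeral mult_pos_pos)
      obtain r where r: "r \<in> \<rat>" "t < r" "r < t + \<delta>"
        using Rats_dense_in_real[of t "t + \<delta>"] \<delta> by auto
      then have "r \<in> R"
        using t by (simp add: R_def)
      then obtain j where j: "r = q j"
        using q by (auto simp: bij_betw_def)
      have "cmod (cinner (realize s) (realize t - realize r)) \<le> norm (realize s) * norm (realize t - realize r)"
        by (rule Cauchy_Schwarz_cinner)
      also have "\<dots> \<le> sqrt s * sqrt \<delta>"
      proof (intro mult_mono)
        show "norm (realize s) \<le> sqrt s"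
          using norm_realize[of s] s by (intro real_le_rsqrt) auto
        have "(norm (realize t - realize r))\<^sup>2 \<le> \<delta>"
          using norm_realize_diff[of t r] t r by auto
        then show "norm (realize t - realize r) \<le> sqrt \<delta>"
          by (rule real_le_rsqrt)
      qed (use s in auto)
      also have "\<dots> \<le> sqrt s * (e / (2 * sqrt s + 2))"
      proof (rule mult_left_mono)
        show "sqrt \<delta> \<le> e / (2 * sqrt s + 2)"
          by (rule real_le_lsqrt) (use e s in \<open>auto simp: \<delta>_def\<close>)
      qed (use s in simp)
      also have "\<dots> = e / 2 * (2 * sqrt s / (2 * sqrt s + 2))"
        by (simp add: field_simps)
      also have "\<dots> \<le> e / 2 * 1"
      proof (rule mult_left_mono)
        have "0 < 2 * sqrt s + 2"
          using real_sqrt_gt_zero[OF s] by linarith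
        then show "2 * sqrt s / (2 * sqrt s + 2) \<le> 1"
          by simp
      qed (use e in simp)
      also have "\<dots> = e / 2"
        by simp
      finally have "cmod (cinner (realize s) (realize t - realize r)) \<le> e / 2" .
      moreover have "cinner (realize s) (realize r) = complex_of_real (min s r)"
        unfolding j by (rule cinner_realize_pivot) (use s in simp)
      moreover have "cmod (complex_of_real (min s r) - complex_of_real (min s t)) \<le> e / 2"
      proof -
        have "r - t \<le> e / 2"
          using r(3) unfolding \<delta>_def by linarith
        then show ?thesis
          unfolding of_real_diff[symmetric] norm_of_real using r(2) by (auto simp: min_def)
      qed
      ultimately show ?thesis
        using norm_triangle_ineq[of "cinner (realize s) (realize t - realize r)"
            "complex_of_real (min s r) - complex_of_real (min s t)"]
        by (simp add: cinner_diff_right)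
    qed
    then have "cmod (cinner (realize s) (realize t) - complex_of_real (min s t)) \<le> 0"
      by (rule field_le_epsilon[of _ 0, simplified])
    then show ?thesis
      by simp
  qed
  define k where "k s = (if s > 0 then realize s else 0)" for s
  have "k s \<in> real_seqs" for s
    by (simp add: k_def real_seqs_zero realize_real)
  moreover have "cinner (k s) (k t) = complex_of_real (max 0 (min s t))" for s t
    by (auto simp: k_def cinner_realize)
  moreover have "basis p \<in> span (k ` {0<..})" for p
  proof -
    have "realize ` range q \<subseteq> k ` {0<..}"
      using q_D by (auto simp: k_def)
    then show ?thesis
      using basis_in_span_pivots span_mono by blast
  qed
  ultimately show ?thesis
    by blast
qed


section \<open>The translation semigroup\<close>

lemma span_image_combination:
  fixes k :: "'a \<Rightarrow> 'b::real_vector"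
  assumes "x \<in> span (k ` A)"
  shows "\<exists>F c. finite F \<and> F \<subseteq> A \<and> x = (\<Sum>s\<in>F. c s *\<^sub>R k s)"
  using assms
proof (induction rule: span_induct_alt)
  case base
  then show ?case
    by (intro exI[of _ "{}"]) simp
next
  case (step r y z)
  then obtain F c s where F: "finite F" "F \<subseteq> A" "z = (\<Sum>t\<in>F. c t *\<^sub>R k t)" "s \<in> A" "y = k s"
    by blast
  define c' where "c' t = (if t \<in> F then c t else 0) + (if t = s then r else 0)" for t
  have "(\<Sum>t\<in>insert s F. c' t *\<^sub>R k t)
      = (\<Sum>t\<in>insert s F. (if t \<in> F then c t *\<^sub>R k t else 0)) + (\<Sum>t\<in>insert s F. (if t = s then r *\<^sub>R k t else 0))"
    by (simp only: sum.distrib[symmetric]) (intro sum.cong, auto simp: c'_def scaleR_add_left)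
  also have "(\<Sum>t\<in>insert s F. (if t \<in> F then c t *\<^sub>R k t else 0)) = z"
    unfolding F(3) using F(1) by (intro sum.mono_neutral_cong_right) auto
  also have "(\<Sum>t\<in>insert s F. (if t = s then r *\<^sub>R k t else 0)) = r *\<^sub>R y"
    using F(1,5) by simp
  finally show ?case
    using F by (intro exI[of _ "insert s F"] exI[of _ c']) (simp add: add.commute)
qed

lemma continuous_on_scaleC:
  assumes "continuous_on A f" shows "continuous_on A (\<lambda>t. c *\<^sub>C f t)"
proof -
  have "bounded_linear ((*\<^sub>C) c)"
  proof (rule bounded_linear_intro)
    show "norm (c *\<^sub>C x) \<le> norm x * cmod c" for x
      by (simp add: norm_scaleC)
  qed (simp_all add: scaleC_add_right scaleR_ell2_def scaleC_scaleC mult.commute)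
  then show ?thesis
    by (rule bounded_linear.continuous_on[OF _ assms])
qed

text \<open>
  On the kernel \<open>T\<close> loses the whole norm: removing from \<open>e_q\<close> its components along \<open>N\<close> orthonormal kernel
  vectors does not change \<open>T e_q\<close>. Summed over \<open>q\<close>, the squares of these components give \<open>N\<close>.
\<close>

lemma infinite_defectI:
  fixes T :: "ell2 \<Rightarrow>\<^sub>L ell2"
  assumes T: "clinear T" "contraction T"
    and ker: "\<And>N::nat. N > 0 \<Longrightarrow> \<exists>h. (\<forall>i<N. norm (h i) = 1 \<and> T (h i) = 0)
      \<and> (\<forall>i<N. \<forall>j<N. i \<noteq> j \<longrightarrow> cinner (h i) (h j) = 0)"
  shows "infinite_defect T"
  unfolding infinite_defect_def
proof
  fix k :: nat
  obtain h where h: "\<And>i. i < Suc k \<Longrightarrow> norm (h i) = 1" "\<And>i. i < Suc k \<Longrightarrow> T (h i) = 0"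
    "\<And>i j. i < Suc k \<Longrightarrow> j < Suc k \<Longrightarrow> i \<noteq> j \<Longrightarrow> cinner (h i) (h j) = 0"
    using ker[of "Suc k"] by auto
  have defect: "(\<Sum>i<Suc k. (cmod (coord (h i) q))\<^sup>2) \<le> 1 - (norm (T (basis q)))\<^sup>2" for q
  proof -
    define c where "c i = cinner (basis q) (h i)" for i
    define s where "s = (\<Sum>i<Suc k. c i *\<^sub>C h i)"
    have c: "cmod (c i) = cmod (coord (h i) q)" for i
      by (simp add: c_def cinner_basis_left)
    have "(norm s)\<^sup>2 = (\<Sum>i<Suc k. (cmod (c i))\<^sup>2)"
      unfolding s_def by (intro norm_sum_orthogonal) (use h in auto)
    moreover have "cinner (basis q) s = complex_of_real (\<Sum>i<Suc k. (cmod (c i))\<^sup>2)"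
      unfolding s_def cinner_sum_right cinner_scaleC_right c_def[symmetric]
      by (simp add: complex_norm_square mult.commute del: of_real_power sum.lessThan_Suc)
    ultimately have "(norm (basis q - 1 *\<^sub>C s))\<^sup>2 = 1 - (\<Sum>i<Suc k. (cmod (c i))\<^sup>2)"
      unfolding norm_diff_scaleC_sq by simp
    moreover have "T s = 0"
      unfolding s_def blinfun.sum_right
      by (intro sum.neutral) (auto simp: clinear_scaleC[OF T(1)] h)
    then have "norm (T (basis q)) \<le> norm (basis q - 1 *\<^sub>C s)"
      using contractionD[OF T(2), of "basis q - s"] by (simp add: blinfun.diff_right)
    then have "(norm (T (basis q)))\<^sup>2 \<le> (norm (basis q - 1 *\<^sub>C s))\<^sup>2"
      by (rule power_mono) simp
    ultimately show ?thesis
      by (simp only: c)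
  qed
  have "(\<lambda>M. \<Sum>i<Suc k. (norm (trunc M (h i)))\<^sup>2) \<longlonglongrightarrow> (\<Sum>i<Suc k. (norm (h i))\<^sup>2)"
    by (intro tendsto_sum tendsto_power tendsto_norm trunc_tendsto)
  moreover have "(\<Sum>i<Suc k. (norm (h i))\<^sup>2) = real (Suc k)"
    using h(1) by simp
  ultimately have "\<forall>\<^sub>F M in sequentially. real k < (\<Sum>i<Suc k. (norm (trunc M (h i)))\<^sup>2)"
    by (intro order_tendstoD(1)) auto
  then obtain M where "real k < (\<Sum>i<Suc k. (norm (trunc M (h i)))\<^sup>2)"
    by (auto simp: eventually_sequentially simp del: sum.lessThan_Suc)
  also have "\<dots> = (\<Sum>q\<in>square M. \<Sum>i<Suc k. (cmod (coord (h i) q))\<^sup>2)"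
    unfolding trunc_def norm_restrict_coords by (subst sum.swap) simp
  also have "\<dots> \<le> (\<Sum>q\<in>square M. 1 - (norm (T (basis q)))\<^sup>2)"
    by (intro sum_mono defect)
  finally show "\<exists>F. finite F \<and> real k < (\<Sum>q\<in>F. 1 - (norm (T (basis q)))\<^sup>2)"
    by (intro exI[of _ "square M"]) simp
qed

text \<open>
  Write \<open>basis p\<close> as a combination of vectors \<open>k s\<close> and replace each \<open>k s\<close> by the increment
  \<open>k (s + t) - k t\<close>, that is, translate to the right by \<open>t\<close>. Increments of Brownian motion are stationary, so this
  gives an orthonormal family, and its analysis operator is the left translation \<open>U t\<close>. All semigroup
  properties, and the three properties of \<open>U 1\<close> that put it into the orbit, are read off from
  \<open>U t (k r) = k (r - t)\<close>.
\<close>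

lemma translation_semigroup:
  "\<exists>U. real_contractive_C0_semigroup U \<and> U 1 \<in> real_unitary_orbit backward_shift"
proof -
  obtain k :: "real \<Rightarrow> ell2" where real: "\<And>s. k s \<in> real_seqs"
    and inner: "\<And>s t. cinner (k s) (k t) = complex_of_real (max 0 (min s t))"
    and total: "\<And>p. basis p \<in> span (k ` {0<..})"
    using Brownian_vectors by blast
  have k_nonpos: "k s = 0" if "s \<le> 0" for s
    using inner[of s s] that by (simp add: cinner_self)
  have "\<exists>F c. finite F \<and> F \<subseteq> {0<..} \<and> basis p = (\<Sum>s\<in>F. c s *\<^sub>R k s)" for p
    by (rule span_image_combination[OF total])
  then obtain F c where F: "\<And>p. finite (F p)" "\<And>p. F p \<subseteq> {0<..}"
    and basis: "\<And>p. basis p = (\<Sum>s\<in>F p. c p s *\<^sub>R k s)"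
    by metis
  define g where "g t p = (\<Sum>s\<in>F p. c p s *\<^sub>R (k (s + t) - k t))" for t p
  have increments: "cinner (k (s + t) - k t) (k (r + t) - k t) = cinner (k s) (k r)"
    if "t \<ge> 0" "s > 0" "r > 0" for s r t
    using that by (simp add: cinner_diff_left cinner_diff_right inner flip: of_real_diff)
  have g_orth: "cinner (g t p) (g t p') = (if p = p' then 1 else 0)" if "t \<ge> 0" for t p p'
  proof -
    have "cinner (g t p) (g t p') = (\<Sum>r\<in>F p'. \<Sum>s\<in>F p. complex_of_real (c p' r)
        * (complex_of_real (c p s) * cinner (k s) (k r)))"
      unfolding g_def cinner_sum_left cinner_sum_right cinner_scaleR_left cinner_scaleR_right sum_distrib_left
    proof (intro sum.cong refl)
      fix r s assume "r \<in> F p'" "s \<in> F p"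
      then have "0 < s" "0 < r"
        using F(2)[of p] F(2)[of p'] by auto
      then show "complex_of_real (c p' r) * (complex_of_real (c p s) * cinner (k (s + t) - k t) (k (r + t) - k t))
          = complex_of_real (c p' r) * (complex_of_real (c p s) * cinner (k s) (k r))"
        by (simp only: increments[OF that])
    qed
    also have "\<dots> = cinner (basis p) (basis p')"
      unfolding basis cinner_sum_left cinner_sum_right cinner_scaleR_left cinner_scaleR_right sum_distrib_left ..
    also have "\<dots> = (if p = p' then 1 else 0)"
      by (auto simp: cinner_basis_right coord_basis)
    finally show ?thesis .
  qed
  have "\<exists>S. real_operator S \<and> contraction S \<and> (\<forall>x p. coord (S x) p = cinner x (g t p))
      \<and> (\<forall>y. S (adj S y) = y)" if t: "t \<ge> 0" for t
  proof -
    have "norm (g t p) = 1" for p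
      by (rule norm_eq_1I) (simp add: g_orth t)
    moreover have "g t p \<in> real_seqs" for p
      unfolding g_def by (intro real_seqs_sum real_seqs_scaleR real_seqs_diff real)
    moreover have "cinner (g t p) (g t p') = 0" if "p \<noteq> p'" for p p'
      using g_orth[OF t] that by simp
    ultimately show ?thesis
      using orthonormal_analysis[of "g t"] by blast
  qed
  then obtain U where U: "\<And>t. t \<ge> 0 \<Longrightarrow> real_operator (U t)" "\<And>t. t \<ge> 0 \<Longrightarrow> contraction (U t)"
    "\<And>t x p. t \<ge> 0 \<Longrightarrow> coord (U t x) p = cinner x (g t p)"
    "\<And>t y. t \<ge> 0 \<Longrightarrow> U t (adj (U t) y) = y"
    by metis
  have cl: "clinear (U t)" if "t \<ge> 0" for t
    using U(1)[OF that] by (simp add: real_operator_def)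
  have Uk: "U t (k r) = k (r - t)" if t: "t \<ge> 0" for t r
  proof (rule ell2_eqI)
    fix p
    have "coord (U t (k r)) p = (\<Sum>s\<in>F p. complex_of_real (c p s) * (cinner (k r) (k (s + t)) - cinner (k r) (k t)))"
      by (simp add: U(3)[OF t] g_def cinner_simps)
    also have "\<dots> = (\<Sum>s\<in>F p. complex_of_real (c p s) * cinner (k (r - t)) (k s))"
    proof (intro sum.cong refl)
      fix s assume "s \<in> F p"
      then have "s > 0"
        using F(2)[of p] by auto
      then have "max 0 (min r (s + t)) - max 0 (min r t) = max 0 (min (r - t) s)"
        using t by (auto simp: min_def max_def)
      then show "complex_of_real (c p s) * (cinner (k r) (k (s + t)) - cinner (k r) (k t))
          = complex_of_real (c p s) * cinner (k (r - t)) (k s)"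
        unfolding inner of_real_diff[symmetric] by simp
    qed
    also have "\<dots> = cinner (k (r - t)) (basis p)"
      by (simp add: basis cinner_simps)
    finally show "coord (U t (k r)) p = coord (k (r - t)) p"
      by (simp add: cinner_basis_right)
  qed
  have eqI: "A = B" if "clinear A" "clinear B" "\<And>s. A (k s) = B (k s)" for A B :: "ell2 \<Rightarrow>\<^sub>L ell2"
  proof (rule clinear_eqI[OF that(1,2)])
    show "A (basis p) = B (basis p)" for p
      unfolding basis blinfun.sum_right blinfun.scaleR_right that(3) ..
  qed
  have U0: "U 0 = id_blinfun"
    by (rule eqI) (simp_all add: cl Uk, simp add: clinear_def)
  have Uadd: "U (s + t) = U s o\<^sub>L U t" if "s \<ge> 0" "t \<ge> 0" for s t
    by (rule eqI) (use that in \<open>simp_all add: cl Uk clinear_compose algebra_simps\<close>)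
  have k_cont: "continuous_on A (\<lambda>t. k (r - t))" for A r
  proof -
    have lip: "(norm (k s - k t))\<^sup>2 \<le> \<bar>s - t\<bar>" for s t
    proof -
      have "(norm (k s - k t))\<^sup>2 = max 0 s - 2 * max 0 (min s t) + max 0 t"
        by (simp add: norm_sq_cinner cinner_diff_left cinner_diff_right inner min.commute)
      then show ?thesis
        by (auto simp: min_def max_def)
    qed
    have "isCont k s" for s
      unfolding continuous_at_eps_delta
    proof (intro allI impI)
      fix e :: real assume e: "e > 0"
      have "dist (k t) (k s) < e" if "dist t s < e\<^sup>2" for t
      proof -
        have "(norm (k t - k s))\<^sup>2 < e\<^sup>2"
          using lip[of t s] that by (simp add: dist_real_def)
        then show ?thesis
          using e by (simp add: dist_norm power2_less_imp_less)
      qed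
      then show "\<exists>d>0. \<forall>t. dist t s < d \<longrightarrow> dist (k t) (k s) < e"
        using e by (intro exI[of _ "e\<^sup>2"]) auto
    qed
    then have "continuous_on UNIV k"
      by (simp add: continuous_at_imp_continuous_on)
    then show ?thesis
      by (rule continuous_on_compose2) (auto intro!: continuous_intros)
  qed
  have U_cont: "continuous_on {0..} (\<lambda>t. U t x)" for x
  proof -
    have b: "continuous_on {0..} (\<lambda>t. U t (basis p))" for p
    proof -
      have "continuous_on {0..} (\<lambda>t. \<Sum>s\<in>F p. c p s *\<^sub>R k (s - t))"
        by (intro continuous_intros k_cont)
      moreover have "(\<Sum>s\<in>F p. c p s *\<^sub>R k (s - t)) = U t (basis p)" if "t \<in> {0..}" for t
        using that by (simp add: basis blinfun.sum_right blinfun.scaleR_right Uk)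
      ultimately show ?thesis
        by (rule continuous_on_eq)
    qed
    have tr: "continuous_on {0..} (\<lambda>t. U t (trunc n x))" for n
    proof -
      have "continuous_on {0..} (\<lambda>t. \<Sum>p\<in>square n. coord x p *\<^sub>C U t (basis p))"
        by (intro continuous_intros continuous_on_scaleC b)
      moreover have "(\<Sum>p\<in>square n. coord x p *\<^sub>C U t (basis p)) = U t (trunc n x)" if "t \<in> {0..}" for t
        using that by (simp add: trunc_sum blinfun.sum_right clinear_scaleC cl)
      ultimately show ?thesis
        by (rule continuous_on_eq)
    qed
    have "uniform_limit {0..} (\<lambda>n t. U t (trunc n x)) (\<lambda>t. U t x) sequentially"
    proof (rule uniform_limitI)
      fix e :: real assume "e > 0"
      then have "\<forall>\<^sub>F n in sequentially. dist (trunc n x) x < e"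
        by (rule tendstoD[OF trunc_tendsto])
      then show "\<forall>\<^sub>F n in sequentially. \<forall>t\<in>{0..}. dist (U t (trunc n x)) (U t x) < e"
      proof eventually_elim
        case (elim n)
        have "dist (U t (trunc n x)) (U t x) \<le> dist (trunc n x) x" if "t \<ge> 0" for t
          using contractionD[OF U(2)[OF that], of "trunc n x - x"] by (simp add: dist_norm blinfun.diff_right)
        then show ?case
          using elim by (auto intro: le_less_trans)
      qed
    qed
    then show ?thesis
      by (rule uniform_limit_theorem[OF always_eventually[OF allI[OF tr]]]) simp
  qed
  have sg: "real_contractive_C0_semigroup U"
    unfolding real_contractive_C0_semigroup_def C0_semigroup_def
    using cl U0 Uadd U_cont U(1,2) by blast
  have pow: "(blinfun_apply (U 1) ^^ n) x = U (real n) x" for n x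
  proof (induction n)
    case (Suc n)
    then show ?case
      using Uadd[of 1 "real n"] by simp
  qed (simp add: U0)
  have "U 1 \<in> real_unitary_orbit backward_shift"
  proof (rule Wold_backward_shift)
    show "coisometric (U 1)"
      using U(4)[of 1] by (simp add: coisometric_def)
    show "infinite_defect (U 1)"
    proof (rule infinite_defectI)
      fix N :: nat assume N: "N > 0"
      \<comment> \<open>normalized increments over the \<open>N\<close> equal parts of \<open>(0, 1]\<close>, all translated out by \<open>U 1\<close>\<close>
      define h where "h i = sqrt (real N) *\<^sub>R (k (real (Suc i) / N) - k (real i / N))" for i
      have inc: "cinner (k (real (Suc i) / N) - k (real i / N)) (k (real (Suc j) / N) - k (real j / N))
          = (if i = j then complex_of_real (1 / N) else 0)" for i j
      proof -
        define f where "f m = real m / N" for m :: nat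
        have mono: "f m \<le> f n" if "m \<le> n" for m n
          using that N by (simp add: f_def divide_right_mono)
        have f0: "0 \<le> f m" for m
          by (simp add: f_def)
        have step: "f (Suc m) - f m = 1 / N" for m
          by (simp add: f_def add_divide_distrib)
        consider "i = j" | "Suc i \<le> j" | "Suc j \<le> i"
          by linarith
        then have "min (f (Suc i)) (f (Suc j)) - min (f (Suc i)) (f j)
            - (min (f i) (f (Suc j)) - min (f i) (f j)) = (if i = j then 1 / N else 0)"
        proof cases
          case 1
          then show ?thesis
            using step[of i] mono[of i "Suc i"] by simp
        next
          case 2
          then show ?thesis
            using mono[OF 2] mono[of i "Suc i"] mono[of j "Suc j"] by (simp add: min_def)
        next
          case 3
          then show ?thesis
            using mono[OF 3] mono[of i "Suc i"] mono[of j "Suc j"] by (simp add: min_def)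
        qed
        moreover have "cinner (k (f (Suc i)) - k (f i)) (k (f (Suc j)) - k (f j))
          = complex_of_real (min (f (Suc i)) (f (Suc j)) - min (f (Suc i)) (f j)
            - (min (f i) (f (Suc j)) - min (f i) (f j)))"
          by (simp add: cinner_diff_left cinner_diff_right inner f0 max_absorb2)
        ultimately show ?thesis
          unfolding f_def by simp
      qed
      have h_orth: "cinner (h i) (h j) = (if i = j then 1 else 0)" for i j
      proof -
        have "complex_of_real (sqrt (real N)) * (complex_of_real (sqrt (real N)) * complex_of_real (1 / N)) = 1"
          using N by (simp flip: of_real_mult)
        then show ?thesis
          unfolding h_def cinner_scaleR_left cinner_scaleR_right inc by auto
      qed
      have "norm (h i) = 1" for i
        by (rule norm_eq_1I) (simp add: h_orth)
      moreover have "U 1 (h i) = 0" if "i < N" for i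
        using that N by (simp add: h_def blinfun.diff_right blinfun.scaleR_right Uk k_nonpos)
      ultimately show "\<exists>h. (\<forall>i<N. norm (h i) = 1 \<and> U 1 (h i) = 0)
          \<and> (\<forall>i<N. \<forall>j<N. i \<noteq> j \<longrightarrow> cinner (h i) (h j) = 0)"
        using h_orth by (intro exI[of _ h]) auto
    qed (simp_all add: cl U)
    show "(\<lambda>n. (blinfun_apply (U 1) ^^ n) (basis p)) \<longlonglongrightarrow> 0" for p
    proof -
      have "\<forall>\<^sub>F n in sequentially. (blinfun_apply (U 1) ^^ n) (basis p) = 0"
      proof -
        obtain M :: nat where M: "\<And>s. s \<in> F p \<Longrightarrow> s \<le> real M"
        proof
          show "s \<le> real (nat \<lceil>Max (insert 0 (F p))\<rceil>)" if "s \<in> F p" for s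
            using that F(1) by (metis Max_ge finite_insert insertI2 of_nat_ceiling order_trans)
        qed
        have "U (real n) (basis p) = 0" if "n \<ge> M" for n
        proof -
          have "k (s - real n) = 0" if "s \<in> F p" for s
            using M[OF that] \<open>n \<ge> M\<close> by (intro k_nonpos) (simp add: order_trans)
          then show ?thesis
            by (simp add: basis blinfun.sum_right blinfun.scaleR_right Uk)
        qed
        then show ?thesis
          unfolding pow eventually_sequentially by blast
      qed
      then show ?thesis
        by (rule tendsto_eventually)
    qed
  qed (simp_all add: U)
  with sg show ?thesis
    by blast
qed

section \<open>Conjugating the semigroup\<close>

lemma orbit_embeddable:
  assumes U: "real_contractive_C0_semigroup U" "U 1 \<in> real_unitary_orbit A"
    and T: "T \<in> real_unitary_orbit A"
  shows "T \<in> embeddable_real_contractions"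
proof -
  obtain S where S: "real_operator S" "unitary S" "U 1 = adj S o\<^sub>L A o\<^sub>L S"
    using orbit_conjugate[OF U(2)] by blast
  obtain R where R: "real_operator R" "unitary R" "T = adj R o\<^sub>L A o\<^sub>L R"
    using orbit_conjugate[OF T] by blast
  have cl: "clinear S" "clinear R"
    using S R by (auto simp: real_operator_def)
  \<comment> \<open>\<open>T = Q* (U 1) Q\<close>, because \<open>A = S (U 1) S*\<close>\<close>
  define Q where "Q = adj S o\<^sub>L R"
  define Q' where "Q' = adj R o\<^sub>L S"
  have Q: "real_operator Q" "contraction Q" "real_operator Q'" "contraction Q'"
    using S R cl by (simp_all add: Q_def Q'_def real_operator_compose real_operator_adj
        contraction_compose contraction_adj unitary_contraction)
  have Q_inv: "Q (Q' x) = x" "Q' (Q x) = x" for x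
    by (simp_all add: Q_def Q'_def unitary_adj[OF S(2)] unitary_adj[OF R(2)])
  define W where "W t = Q' o\<^sub>L U t o\<^sub>L Q" for t
  have U': "\<And>t. t \<ge> 0 \<Longrightarrow> real_operator (U t)" "\<And>t. t \<ge> 0 \<Longrightarrow> contraction (U t)"
    "U 0 = id_blinfun" "\<And>s t. s \<ge> 0 \<Longrightarrow> t \<ge> 0 \<Longrightarrow> U (s + t) = U s o\<^sub>L U t"
    "\<And>x. continuous_on {0..} (\<lambda>t. U t x)"
    using U(1) by (auto simp: real_contractive_C0_semigroup_def C0_semigroup_def)
  have W: "real_operator (W t)" "contraction (W t)" if "t \<ge> 0" for t
    using Q U'(1,2)[OF that] by (simp_all add: W_def real_operator_compose contraction_compose)
  have "real_contractive_C0_semigroup W"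
    unfolding real_contractive_C0_semigroup_def C0_semigroup_def
  proof (intro conjI allI impI)
    show "W 0 = id_blinfun"
      by (rule blinfun_eqI) (simp add: W_def U'(3) Q_inv)
    show "W (s + t) = W s o\<^sub>L W t" if "s \<ge> 0" "t \<ge> 0" for s t
      by (rule blinfun_eqI) (simp add: W_def U'(4)[OF that] Q_inv)
    show "continuous_on {0..} (\<lambda>t. W t x)" for x
      unfolding W_def using U'(5)[of "Q x"] by (simp add: blinfun.continuous_on)
  qed (use W in \<open>auto simp: real_operator_def\<close>)
  moreover have W1: "W 1 = T"
    by (rule blinfun_eqI) (simp add: W_def S(3) R(3) Q_def Q'_def unitary_adj[OF S(2)])
  moreover have "T \<in> real_contractions"
    using W[of 1] W1 by (simp add: real_contractions_def)
  ultimately show ?thesis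
    by (auto simp: embeddable_real_contractions_def)
qed


theorem theorem5p2:
  shows "residual_in sot_real_contractions (real_unitary_orbit backward_shift)
    \<and> real_unitary_orbit backward_shift \<subseteq> embeddable_real_contractions
    \<and> residual_in sot_real_contractions embeddable_real_contractions"
proof -
  have embed: "real_unitary_orbit backward_shift \<subseteq> embeddable_real_contractions"
    using translation_semigroup orbit_embeddable by blast
  moreover have "embeddable_real_contractions \<subseteq> topspace sot_real_contractions"
    by (auto simp: embeddable_real_contractions_def)
  ultimately show ?thesis
    using residual_orbit residual_in_superset by blast
qed

end
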